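(* Let $I=(a_\infty,b_\infty)$. The sequence $h_j=f_j^{3/2}$, after possibly passing to a subsequence, converges in $H^1_{loc}(I)$ to some $h_\infty\in H^1(I)$. Defining $f_\infty=h_\infty^{2/3}$, a subsequence of $f_j$ also converges in $H^1_{loc}(I)$ to $f_\infty\in H^1(I)$.
   Context: Let $D,A>0$. For $j\in\mathbb N$, $M_j$ is diffeomorphic to $\mathbb S^3$ with a smooth rotationally symmetric metric $g_j=ds^2+f_j(s)^2g_{\mathbb S^2}$, $0\le s\le D_j$, where $g_{\mathbb S^2}$ is the round unit-sphere metric and $f_j$ is smooth on $[0,D_j]$ with $f_j(0)=f_j(D_j)=0$, $f_j>0$ on $(0,D_j)$, $f_j'(0)=1$, $f_j'(D_j)=-1$. Assume for all $j$ that $\operatorname{Diam}(M_j)\le D$ (so $D_j\le D$), $\operatorname{Scalar}_j\ge0$, and $\operatorname{MinA}(M_j)\ge A>0$, where $\operatorname{MinA}(M_j)$ is the infimum of areas of closed embedded minimal surfaces in $M_j$. Extend $f_j$ by $0$ to $[D_j,D]$. After passing to a subsequence, $f_j$ converges uniformly on $[0,D]$ to a function, denoted $f_\infty$, which is Lipschitz with constant $1$ (the function $h_\infty^{2/3}$ in the claim agrees on $I$ with this uniform limit). Set $a_\infty=\sup\{s: f_\infty=0\text{ on }[0,s]\}$ and $b_\infty=\inf\{s: f_\infty=0\text{ on }[s,D]\}$, with $f_\infty$ the uniform limit; then $\{f_\infty>0\}=(a_\infty,b_\infty)$. *)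

theory Defs
  imports "HOL-Analysis.Analysis"
begin

section \<open>Smooth maps and embedded submanifolds of Euclidean space\<close>

primrec Ck_on :: "nat \<Rightarrow> 'a::euclidean_space set \<Rightarrow> ('a \<Rightarrow> 'b::real_normed_vector) \<Rightarrow> bool" where
  "Ck_on 0 U F \<longleftrightarrow> continuous_on U F"
| "Ck_on (Suc k) U F \<longleftrightarrow>
     (\<forall>x\<in>U. F differentiable (at x)) \<and>
     (\<forall>e\<in>Basis. Ck_on k U (\<lambda>x. frechet_derivative F (at x) e))"

text \<open>On a set that need not be open, smooth means: restriction of a smooth function on an open
  neighbourhood. In particular this gives smoothness up to the end points on a closed interval.\<close>

definition smooth_on :: "'a::euclidean_space set \<Rightarrow> ('a \<Rightarrow> 'b::real_normed_vector) \<Rightarrow> bool" where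
  "smooth_on S F \<longleftrightarrow>
     (\<exists>U G. open U \<and> S \<subseteq> U \<and> (\<forall>k. Ck_on k U G) \<and> (\<forall>x\<in>S. G x = F x))"

definition pd :: "'n::finite \<Rightarrow> (real^'n \<Rightarrow> 'b::real_normed_vector) \<Rightarrow> real^'n \<Rightarrow> 'b" where
  "pd i F x = frechet_derivative F (at x) (axis i 1)"

text \<open>A local parametrization (inverse of a chart) of an embedded submanifold \<open>S\<close>.\<close>

definition local_param ::
  "(real^'n::finite \<Rightarrow> 'a::euclidean_space) \<Rightarrow> (real^'n) set \<Rightarrow> 'a set \<Rightarrow> bool" where
  "local_param \<phi> U S \<longleftrightarrow>
     open U \<and> smooth_on U \<phi> \<and>
     (\<forall>x\<in>U. inj (frechet_derivative \<phi> (at x))) \<and>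
     openin (top_of_set S) (\<phi> ` U) \<and>
     (\<exists>\<psi>. homeomorphism U (\<phi> ` U) \<phi> \<psi>)"

text \<open>A (0,2)-tensor field is a map \<open>g\<close>, where \<open>g p u v\<close> is only meaningful for
  tangent vectors \<open>u\<close>, \<open>v\<close> at the point \<open>p\<close>. The following are its components
  in the coordinates given by \<open>\<phi>\<close>.\<close>

definition metric_coeff ::
  "('a::euclidean_space \<Rightarrow> 'a \<Rightarrow> 'a \<Rightarrow> real) \<Rightarrow> (real^'n::finite \<Rightarrow> 'a) \<Rightarrow> real^'n \<Rightarrow> real^'n^'n" where
  "metric_coeff g \<phi> x = (\<chi> i j. g (\<phi> x) (pd i \<phi> x) (pd j \<phi> x))"

section \<open>Riemannian metrics on the 3-sphere\<close>

type_synonym pt = "(real^3) \<times> real"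

type_synonym metric = "pt \<Rightarrow> pt \<Rightarrow> pt \<Rightarrow> real"

definition S3 :: "pt set" where
  "S3 = sphere 0 1"

definition tangent :: "pt \<Rightarrow> pt set" where
  "tangent p = {u. u \<bullet> p = 0}"

definition riemannian_metric :: "metric \<Rightarrow> bool" where
  "riemannian_metric g \<longleftrightarrow>
     (\<forall>p\<in>S3. \<forall>u\<in>tangent p. \<forall>v\<in>tangent p.
        g p u v = g p v u \<and>
        (u \<noteq> 0 \<longrightarrow> 0 < g p u u) \<and>
        (\<forall>w\<in>tangent p. \<forall>c. g p (c *\<^sub>R u + v) w = c * g p u w + g p v w)) \<and>
     (\<forall>(\<phi> :: real^3 \<Rightarrow> pt) U. local_param \<phi> U S3 \<longrightarrow>
        (\<forall>i j. smooth_on U (\<lambda>x. metric_coeff g \<phi> x $ i $ j)))"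

text \<open>Polar coordinates \<open>(s, \<omega>)\<close>, \<open>0 \<le> s \<le> l\<close>, \<open>\<omega>\<close> in the unit 2-sphere, on the
  3-sphere: \<open>s = 0\<close> and \<open>s = l\<close> are the two poles. A manifold diffeomorphic to the
  3-sphere with a smooth metric \<open>ds^2 + f(s)^2 g\<^sub>S\<close> is identified with the unit
  3-sphere through these coordinates.\<close>

definition polar :: "real \<Rightarrow> real \<times> (real^3) \<Rightarrow> pt" where
  "polar l = (\<lambda>(s, \<omega>). (sin (pi * s / l) *\<^sub>R \<omega>, cos (pi * s / l)))"

text \<open>The pullback of \<open>g\<close> under polar coordinates is \<open>ds^2 + f(s)^2 g\<^sub>S\<close>; here
  \<open>(a, u)\<close>, \<open>(b, v)\<close> are tangent vectors of the product of the interval and the unit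
  2-sphere. Smoothness of \<open>g\<close> at the poles is part of \<open>riemannian_metric\<close>.\<close>

definition rot_sym_metric :: "real \<Rightarrow> (real \<Rightarrow> real) \<Rightarrow> metric \<Rightarrow> bool" where
  "rot_sym_metric l f g \<longleftrightarrow>
     riemannian_metric g \<and>
     (\<forall>s\<in>{0<..<l}. \<forall>\<omega>\<in>sphere 0 1. \<forall>a b u v. u \<bullet> \<omega> = 0 \<longrightarrow> v \<bullet> \<omega> = 0 \<longrightarrow>
        g (polar l (s, \<omega>))
          (frechet_derivative (polar l) (at (s, \<omega>)) (a, u))
          (frechet_derivative (polar l) (at (s, \<omega>)) (b, v))
        = a * b + (f s)\<^sup>2 * (u \<bullet> v))"

subsection \<open>Diameter\<close>

text \<open>The length is taken in \<open>ennreal\<close> because \<open>valid_path\<close> (piecewise continuously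
  differentiable) allows the derivative to blow up at finitely many points, so that the length
  may be infinite.\<close>

definition curve_length :: "metric \<Rightarrow> (real \<Rightarrow> pt) \<Rightarrow> ennreal" where
  "curve_length g \<gamma> =
     (\<integral>\<^sup>+t\<in>{0..1}. ennreal (sqrt (g (\<gamma> t) (vector_derivative \<gamma> (at t))
                                         (vector_derivative \<gamma> (at t)))) \<partial>lborel)"

definition riem_dist :: "metric \<Rightarrow> pt \<Rightarrow> pt \<Rightarrow> ennreal" where
  "riem_dist g p q = Inf {curve_length g \<gamma> | \<gamma>.
     valid_path \<gamma> \<and> path_image \<gamma> \<subseteq> S3 \<and> pathstart \<gamma> = p \<and> pathfinish \<gamma> = q}"

definition Diam :: "metric \<Rightarrow> ennreal" where
  "Diam g = (SUP p\<in>S3. SUP q\<in>S3. riem_dist g p q)"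

subsection \<open>Scalar curvature\<close>

text \<open>In these definitions \<open>G\<close> is the matrix of metric components as a function of the coordinates.\<close>

definition christoffel ::
  "(real^'n::finite \<Rightarrow> real^'n^'n) \<Rightarrow> 'n \<Rightarrow> 'n \<Rightarrow> 'n \<Rightarrow> real^'n \<Rightarrow> real" where
  "christoffel G k i j x =
     (\<Sum>l\<in>UNIV. matrix_inv (G x) $ k $ l *
        (pd i (\<lambda>y. G y $ j $ l) x + pd j (\<lambda>y. G y $ i $ l) x - pd l (\<lambda>y. G y $ i $ j) x)) / 2"

definition ricci :: "(real^'n::finite \<Rightarrow> real^'n^'n) \<Rightarrow> 'n \<Rightarrow> 'n \<Rightarrow> real^'n \<Rightarrow> real" where
  "ricci G i j x =
     (\<Sum>k\<in>UNIV. pd k (christoffel G k i j) x - pd j (christoffel G k i k) x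
       + (\<Sum>l\<in>UNIV. christoffel G k k l x * christoffel G l i j x
                   - christoffel G k j l x * christoffel G l i k x))"

definition scal :: "(real^'n::finite \<Rightarrow> real^'n^'n) \<Rightarrow> real^'n \<Rightarrow> real" where
  "scal G x = (\<Sum>i\<in>UNIV. \<Sum>j\<in>UNIV. matrix_inv (G x) $ i $ j * ricci G i j x)"

text \<open>The value does not depend on the coordinates in which it is computed; the same applies to
  mean curvature and area below. These notions are therefore relations between a geometric
  object and its value.\<close>

definition has_scalar_curvature :: "metric \<Rightarrow> pt \<Rightarrow> real \<Rightarrow> bool" where
  "has_scalar_curvature g p c \<longleftrightarrow>
     (\<exists>(\<phi> :: real^3 \<Rightarrow> pt) U x. local_param \<phi> U S3 \<and> x \<in> U \<and> \<phi> x = p \<and>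
        c = scal (metric_coeff g \<phi>) x)"

definition nonneg_scalar_curvature :: "metric \<Rightarrow> bool" where
  "nonneg_scalar_curvature g \<longleftrightarrow> (\<forall>p\<in>S3. \<forall>c. has_scalar_curvature g p c \<longrightarrow> 0 \<le> c)"

subsection \<open>Closed embedded minimal surfaces and their area\<close>

definition closed_embedded_surface :: "pt set \<Rightarrow> bool" where
  "closed_embedded_surface \<Sigma> \<longleftrightarrow>
     \<Sigma> \<subseteq> S3 \<and> \<Sigma> \<noteq> {} \<and> compact \<Sigma> \<and> connected \<Sigma> \<and>
     (\<forall>p\<in>\<Sigma>. \<exists>(\<phi> :: real^2 \<Rightarrow> pt) U. local_param \<phi> U \<Sigma> \<and> p \<in> \<phi> ` U)"

text \<open>For a parametrized surface \<open>X\<close> in the coordinate domain, this is the covariant derivative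
  of the tangent field \<open>pd b X\<close> in the direction \<open>pd a X\<close>.\<close>

definition cov_pd ::
  "(real^3 \<Rightarrow> real^3^3) \<Rightarrow> (real^2 \<Rightarrow> real^3) \<Rightarrow> 2 \<Rightarrow> 2 \<Rightarrow> real^2 \<Rightarrow> real^3" where
  "cov_pd G X a b z = (\<chi> k. pd a (\<lambda>y. pd b X y $ k) z
     + (\<Sum>i\<in>UNIV. \<Sum>j\<in>UNIV. christoffel G k i j (X z) * (pd a X z $ i) * (pd b X z $ j)))"

text \<open>Mean curvature at \<open>p\<close> with respect to one of the two unit normals: the trace of the second
  fundamental form with respect to the induced metric. The surface is parametrized by \<open>\<phi> \<circ> X\<close>,
  where \<open>\<phi>\<close> gives coordinates on the 3-sphere, and \<open>\<nu>\<close> is the unit normal in these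
  coordinates.\<close>

definition has_mean_curvature :: "metric \<Rightarrow> pt set \<Rightarrow> pt \<Rightarrow> real \<Rightarrow> bool" where
  "has_mean_curvature g \<Sigma> p c \<longleftrightarrow>
     (\<exists>(\<phi> :: real^3 \<Rightarrow> pt) U (X :: real^2 \<Rightarrow> real^3) V z \<nu>.
        local_param \<phi> U S3 \<and>
        smooth_on V X \<and> X ` V \<subseteq> U \<and> local_param (\<phi> \<circ> X) V \<Sigma> \<and>
        z \<in> V \<and> \<phi> (X z) = p \<and>
        \<nu> \<bullet> (metric_coeff g \<phi> (X z) *v \<nu>) = 1 \<and>
        (\<forall>a. pd a X z \<bullet> (metric_coeff g \<phi> (X z) *v \<nu>) = 0) \<and>
        c = (\<Sum>a\<in>UNIV. \<Sum>b\<in>UNIV. matrix_inv (metric_coeff g (\<phi> \<circ> X) z) $ a $ b *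
               (cov_pd (metric_coeff g \<phi>) X a b z \<bullet> (metric_coeff g \<phi> (X z) *v \<nu>))))"

definition minimal_surface :: "metric \<Rightarrow> pt set \<Rightarrow> bool" where
  "minimal_surface g \<Sigma> \<longleftrightarrow> (\<forall>p\<in>\<Sigma>. has_mean_curvature g \<Sigma> p 0)"

text \<open>The area is computed by cutting the surface into finitely many disjoint Borel pieces, each
  contained in the image of a local parametrization.\<close>

definition has_area :: "metric \<Rightarrow> pt set \<Rightarrow> ennreal \<Rightarrow> bool" where
  "has_area g \<Sigma> a \<longleftrightarrow>
     (\<exists>n (\<phi> :: nat \<Rightarrow> real^2 \<Rightarrow> pt) U B.
        (\<forall>i<n. local_param (\<phi> i) (U i) \<Sigma> \<and> B i \<in> sets borel \<and> B i \<subseteq> U i) \<and>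
        disjoint_family_on (\<lambda>i. \<phi> i ` B i) {..<n} \<and>
        (\<Union>i<n. \<phi> i ` B i) = \<Sigma> \<and>
        a = (\<Sum>i<n. \<integral>\<^sup>+x\<in>B i. ennreal (sqrt (det (metric_coeff g (\<phi> i) x))) \<partial>lborel))"

definition MinA :: "metric \<Rightarrow> ennreal" where
  "MinA g = Inf {a. \<exists>\<Sigma>. closed_embedded_surface \<Sigma> \<and> minimal_surface g \<Sigma> \<and> has_area g \<Sigma> a}"

section \<open>Sobolev spaces on open subsets of the real line\<close>

definition test_fun :: "real set \<Rightarrow> (real \<Rightarrow> real) \<Rightarrow> bool" where
  "test_fun J \<phi> \<longleftrightarrow>
     smooth_on UNIV \<phi> \<and> compact (closure {x. \<phi> x \<noteq> 0}) \<and> closure {x. \<phi> x \<noteq> 0} \<subseteq> J"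

definition L2_on :: "real set \<Rightarrow> (real \<Rightarrow> real) \<Rightarrow> bool" where
  "L2_on J u \<longleftrightarrow> set_borel_measurable lebesgue J u \<and> set_integrable lebesgue J (\<lambda>x. (u x)\<^sup>2)"

text \<open>\<open>u\<close> is in \<open>H\<^sup>1(J)\<close> with weak derivative \<open>u'\<close>.\<close>

definition H1_with_deriv :: "real set \<Rightarrow> (real \<Rightarrow> real) \<Rightarrow> (real \<Rightarrow> real) \<Rightarrow> bool" where
  "H1_with_deriv J u u' \<longleftrightarrow>
     L2_on J u \<and> L2_on J u' \<and>
     (\<forall>\<phi>. test_fun J \<phi> \<longrightarrow>
        (LINT x:J|lebesgue. u x * deriv \<phi> x) = - (LINT x:J|lebesgue. u' x * \<phi> x))"

definition H1 :: "real set \<Rightarrow> (real \<Rightarrow> real) set" where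
  "H1 J = {u. \<exists>u'. H1_with_deriv J u u'}"

definition H1_tendsto :: "real set \<Rightarrow> (nat \<Rightarrow> real \<Rightarrow> real) \<Rightarrow> (real \<Rightarrow> real) \<Rightarrow> bool" where
  "H1_tendsto J u v \<longleftrightarrow>
     (\<exists>u' v'. (\<forall>n. H1_with_deriv J (u n) (u' n)) \<and> H1_with_deriv J v v' \<and>
        (\<lambda>n. (LINT x:J|lebesgue. (u n x - v x)\<^sup>2) + (LINT x:J|lebesgue. (u' n x - v' x)\<^sup>2))
          \<longlonglongrightarrow> 0)"

definition H1_loc_tendsto :: "real set \<Rightarrow> (nat \<Rightarrow> real \<Rightarrow> real) \<Rightarrow> (real \<Rightarrow> real) \<Rightarrow> bool" where
  "H1_loc_tendsto I u v \<longleftrightarrow>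
     (\<forall>J. open J \<longrightarrow> compact (closure J) \<longrightarrow> closure J \<subseteq> I \<longrightarrow> H1_tendsto J u v)"

section \<open>Warping functions\<close>

definition zero_ext :: "real \<Rightarrow> (real \<Rightarrow> real) \<Rightarrow> real \<Rightarrow> real" where
  "zero_ext l f s = (if s \<in> {0..l} then f s else 0)"

definition a_inf :: "real \<Rightarrow> (real \<Rightarrow> real) \<Rightarrow> real" where
  "a_inf D F = Sup {s \<in> {0..D}. \<forall>t\<in>{0..s}. F t = 0}"

definition b_inf :: "real \<Rightarrow> (real \<Rightarrow> real) \<Rightarrow> real" where
  "b_inf D F = Inf {s \<in> {0..D}. \<forall>t\<in>{s..D}. F t = 0}"

end

theory Submission
  imports Defs
begin

text \<open>The metric \<open>ds\<^sup>2 + f(s)\<^sup>2 g\<^sub>S\<close> has scalar curvature \<open>- 4 f'' / f + 2 (1 - f'\<^sup>2) / f\<^sup>2\<close>, so nonnegative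
scalar curvature is the inequality \<open>2 f f'' \<le> 1 - f'\<^sup>2\<close> (\<open>scalar_curvature_ineq\<close>). It has two
consequences. First, \<open>f'\<close> decreases strictly wherever \<open>\<bar>f'\<bar> > 1\<close>, and as \<open>f'\<close> starts at \<open>1\<close> and
ends at \<open>-1\<close> this forces \<open>\<bar>f'\<bar> \<le> 1\<close> (\<open>deriv_le_one\<close>). Secondly, \<open>f''\<close> is bounded from above
wherever \<open>f\<close> is bounded away from \<open>0\<close>: there \<open>f\<close> is a concave function plus a fixed quadratic one.

Suppose that the uniform limit is positive on \<open>I\<close>. On a compact subinterval of \<open>I\<close> the functions
\<open>f\<^sub>j\<close> are then, for large \<open>j\<close>, uniformly semiconcave. If concave functions converge pointwise, their
derivatives are trapped between difference quotients, and they converge outside a countable set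
(\<open>concave_derivatives_converge\<close>). Hence \<open>f\<^sub>j'\<close> converges almost everywhere on \<open>I\<close>
(\<open>warping_derivatives_converge\<close>), and so does \<open>(f\<^sub>j\<^bsup>3/2\<^esup>)' = 3/2 f\<^sub>j\<^bsup>1/2\<^esup> f\<^sub>j'\<close>. All these functions are
uniformly bounded, and dominated convergence turns this into strong convergence of the functions and
of their weak derivatives in \<open>L\<^sup>2\<close> (\<open>H1_with_deriv_limit\<close>). The whole given sequence converges, so
the identity serves for both subsequences.

The area hypothesis gives the positivity of the limit on \<open>I\<close>. If the limit vanished between two points
where it is positive, then \<open>f\<^sub>j\<close> would have a local minimum of arbitrarily small height for large
\<open>j\<close>. The sphere of latitude at a critical point of \<open>f\<^sub>j\<close> is a closed embedded minimal surface of area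
at most a constant times \<open>f\<^sub>j\<^sup>2\<close> (\<open>MinA_le\<close>), which contradicts the lower bound for \<open>MinA\<close>
(\<open>limit_pos_between\<close>). The diameter bound enters through the end point \<open>D\<close>: every path between the
poles has length at least \<open>L\<^sub>j\<close> (\<open>Diam_ge\<close>), so \<open>L\<^sub>j \<le> D\<close>, the limit vanishes at \<open>D\<close>, and the infimum
that defines the right end of \<open>I\<close> is taken over a nonempty set.

Curvature, minimality and area are computed in geographic coordinates \<open>(s, \<theta>, \<phi>)\<close>, in which the metric
is the diagonal matrix with entries \<open>1\<close>, \<open>f(s)\<^sup>2\<close>, \<open>f(s)\<^sup>2 cos\<^sup>2 \<theta>\<close>. A rotation of the 2-sphere moves
the centre of these coordinates to any given point.\<close>

section \<open>Smoothness of trigonometric maps\<close>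

lemma Ck_on_Suc_imp: "Ck_on (Suc k) UNIV F \<Longrightarrow> Ck_on k UNIV F"
proof (induction k arbitrary: F)
  case 0
  then show ?case
    by (auto intro!: continuous_at_imp_continuous_on differentiable_imp_continuous_within)
next
  case (Suc k)
  then show ?case by (metis Ck_on.simps(2))
qed

text \<open>The definition of \<open>Ck_on\<close> speaks of \<open>frechet_derivative\<close>; with this rule a derivative given by a formula
can be used instead.\<close>

lemma Ck_on_SucI:
  assumes "\<And>x. (F has_derivative F' x) (at x)"
    and "\<And>e. Ck_on k UNIV (\<lambda>x. F' x e)"
  shows "Ck_on (Suc k) UNIV F"
proof -
  have "frechet_derivative F (at x) = F' x" for x
    using frechet_derivative_at[OF assms(1)] by metis
  then show ?thesis
    using assms by (auto simp: differentiable_def)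
qed

lemma Ck_on_const: "Ck_on k UNIV (\<lambda>_. c)"
proof (induction k arbitrary: c)
  case (Suc k)
  show ?case by (rule Ck_on_SucI[where F' = "\<lambda>_ _. 0"]) (auto intro: Suc)
qed simp

lemma Ck_on_linear:
  assumes "bounded_linear T" shows "Ck_on k UNIV T"
proof (cases k)
  case 0
  then show ?thesis using assms by (simp add: linear_continuous_on)
next
  case (Suc k')
  show ?thesis unfolding Suc
    by (rule Ck_on_SucI[where F' = "\<lambda>_. T"])
      (auto intro!: bounded_linear_imp_has_derivative assms Ck_on_const)
qed

lemma Ck_on_add: "Ck_on k UNIV F \<Longrightarrow> Ck_on k UNIV G \<Longrightarrow> Ck_on k UNIV (\<lambda>x. F x + G x)"
proof (induction k arbitrary: F G)
  case (Suc k)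
  have d: "F differentiable at x" "G differentiable at x" for x
    using Suc.prems by auto
  have "frechet_derivative (\<lambda>x. F x + G x) (at x) e
      = frechet_derivative F (at x) e + frechet_derivative G (at x) e" for x e
    using frechet_derivative_at[OF has_derivative_add[OF
      d(1)[unfolded frechet_derivative_works] d(2)[unfolded frechet_derivative_works]]]
    by metis
  then show ?case
    using Suc d by (auto intro!: differentiable_add)
qed (auto intro: continuous_on_add)

text \<open>Induction with the product rule. The rule brings back the undifferentiated factors, which are one order
smoother than the induction needs; this is the use of \<open>Ck_on_Suc_imp\<close>.\<close>

lemma Ck_on_scaleR:
  fixes c :: "'a::euclidean_space \<Rightarrow> real"
  shows "Ck_on k UNIV c \<Longrightarrow> Ck_on k UNIV G \<Longrightarrow> Ck_on k UNIV (\<lambda>x. c x *\<^sub>R G x)"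
proof (induction k arbitrary: c G)
  case (Suc k)
  have d: "c differentiable at x" "G differentiable at x" for x
    using Suc.prems by auto
  have "frechet_derivative (\<lambda>x. c x *\<^sub>R G x) (at x) e
      = c x *\<^sub>R frechet_derivative G (at x) e + frechet_derivative c (at x) e *\<^sub>R G x" for x e
    using frechet_derivative_at[OF has_derivative_scaleR[OF
      d(1)[unfolded frechet_derivative_works] d(2)[unfolded frechet_derivative_works]]]
    by metis
  moreover have "Ck_on k UNIV c" "Ck_on k UNIV G"
    using Suc.prems by (blast intro: Ck_on_Suc_imp)+
  ultimately show ?case
    using Suc d by (auto intro!: differentiable_scaleR Ck_on_add)
qed (auto intro: continuous_on_scaleR)

lemmas Ck_on_mult = Ck_on_scaleR[where 'b = real, unfolded real_scaleR_def]

lemma Ck_on_sin_cos: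
  fixes T :: "'a::euclidean_space \<Rightarrow> real"
  assumes "bounded_linear T"
  shows "Ck_on k UNIV (\<lambda>x. sin (T x))" "Ck_on k UNIV (\<lambda>x. cos (T x))"
proof (induction k)
  case 0
  have "continuous_on UNIV T" using assms by (simp add: linear_continuous_on)
  then show "Ck_on 0 UNIV (\<lambda>x. sin (T x))" "Ck_on 0 UNIV (\<lambda>x. cos (T x))"
    by (auto intro: continuous_intros)
next
  case (Suc k)
  note [derivative_intros] = bounded_linear_imp_has_derivative[OF assms]
  show "Ck_on (Suc k) UNIV (\<lambda>x. sin (T x))"
    by (rule Ck_on_SucI[where F' = "\<lambda>x e. cos (T x) * T e"])
      (auto intro!: derivative_eq_intros Ck_on_mult Suc Ck_on_const)
  show "Ck_on (Suc k) UNIV (\<lambda>x. cos (T x))"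
    by (rule Ck_on_SucI[where F' = "\<lambda>x e. sin (T x) * (- T e)"])
      (auto intro!: derivative_eq_intros Ck_on_mult[where G = "\<lambda>_. - c" for c, simplified] Suc Ck_on_const)
qed

lemma smooth_on_if_Ck: "(\<And>k. Ck_on k UNIV F) \<Longrightarrow> smooth_on S F"
  unfolding smooth_on_def by blast

section \<open>Geographic coordinates\<close>

text \<open>The components \<open>x$2\<close> and \<open>x$3\<close> are latitude and longitude on the unit 2-sphere. The first component
is kept free for the distance \<open>s\<close> from a pole of the 3-sphere, so that one vector of \<open>real^3\<close> carries all
three coordinates.\<close>

definition geo :: "real^3 \<Rightarrow> real^3" where
  "geo x = (cos (x$2) * cos (x$3)) *\<^sub>R axis 1 1 + (cos (x$2) * sin (x$3)) *\<^sub>R axis 2 1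
     + sin (x$2) *\<^sub>R axis 3 1"

text \<open>The derivative of \<open>geo\<close> at \<open>x\<close> in the direction \<open>v\<close>.\<close>

definition geo' :: "real^3 \<Rightarrow> real^3 \<Rightarrow> real^3" where
  "geo' x v = (- sin (x$2) * cos (x$3) * v$2 - cos (x$2) * sin (x$3) * v$3) *\<^sub>R axis 1 1
     + (cos (x$2) * cos (x$3) * v$3 - sin (x$2) * sin (x$3) * v$2) *\<^sub>R axis 2 1
     + (cos (x$2) * v$2) *\<^sub>R axis 3 1"

lemma has_derivative_nth [derivative_intros]:
  "(f has_derivative f') F \<Longrightarrow> ((\<lambda>x. f x $ i) has_derivative (\<lambda>h. f' h $ i)) F"
  by (rule bounded_linear.has_derivative[OF bounded_linear_vec_nth])

lemma geo_nth [simp]: "geo x $ 1 = cos (x$2) * cos (x$3)"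
  "geo x $ 2 = cos (x$2) * sin (x$3)" "geo x $ 3 = sin (x$2)"
  by (simp_all add: geo_def axis_def)

lemma geo'_nth [simp]:
  "geo' x v $ 1 = - sin (x$2) * cos (x$3) * v$2 - cos (x$2) * sin (x$3) * v$3"
  "geo' x v $ 2 = cos (x$2) * cos (x$3) * v$3 - sin (x$2) * sin (x$3) * v$2"
  "geo' x v $ 3 = cos (x$2) * v$2"
  by (simp_all add: geo'_def axis_def)

lemma geo_has_derivative: "(geo has_derivative geo' x) (at x)"
  unfolding geo_def[abs_def] geo'_def[abs_def]
  by (auto intro!: derivative_eq_intros simp: algebra_simps)

lemma inner_3: "x \<bullet> y = x$1 * y$1 + x$2 * y$2 + x$3 * (y$3::real)" for x y :: "real^3"
  by (simp add: inner_vec_def sum_3)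

lemma geo_inner: "geo x \<bullet> geo x = 1"
proof -
  have "c * c' * (c * c') + c * s' * (c * s') + s * s = c^2 * (s'^2 + c'^2) + s^2"
    for s c s' c' :: real
    by (simp add: power2_eq_square algebra_simps)
  then show ?thesis
    by (simp only: inner_3 geo_nth sin_cos_squared_add sin_cos_squared_add2 mult_1_right)
qed

lemma geo'_inner_geo: "geo' x v \<bullet> geo x = 0"
proof -
  have "(- s * c' * v2 - c * s' * v3) * (c * c')
        + (c * c' * v3 - s * s' * v2) * (c * s') + c * v2 * s = v2 * c * s * (1 - (s'^2 + c'^2))"
    for s c s' c' v2 v3 :: real
    by (simp add: power2_eq_square algebra_simps)
  then show ?thesis
    by (simp add: inner_3)
qed

text \<open>The round metric takes the form \<open>d\<theta>\<^sup>2 + cos\<^sup>2 \<theta> d\<phi>\<^sup>2\<close>: all cross terms cancel, and the rest collects into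
multiples of \<open>sin\<^sup>2 + cos\<^sup>2\<close>.\<close>

lemma geo'_inner_geo': "geo' x v \<bullet> geo' x w = v$2 * w$2 + cos (x$2)^2 * (v$3 * w$3)"
proof -
  have "(- s * c' * v2 - c * s' * v3) * (- s * c' * w2 - c * s' * w3)
        + (c * c' * v3 - s * s' * v2) * (c * c' * w3 - s * s' * w2) + c * v2 * (c * w2)
      = (s^2 * (s'^2 + c'^2) + c^2) * (v2 * w2) + (s'^2 + c'^2) * (c^2 * (v3 * w3))"
    for s c s' c' v2 v3 w2 w3 :: real
    by (simp add: power2_eq_square algebra_simps)
  then show ?thesis
    by (simp only: inner_3 geo'_nth sin_cos_squared_add mult_1_left mult_1_right)
qed

section \<open>Derivative of polar coordinates\<close>

text \<open>The derivative of \<open>polar l\<close> at \<open>(s, \<omega>)\<close>.\<close>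

definition polar' :: "real \<Rightarrow> real \<Rightarrow> real^3 \<Rightarrow> real \<times> (real^3) \<Rightarrow> pt" where
  "polar' l s \<omega> = (\<lambda>(a, u). ((cos (pi * s / l) * (pi / l) * a) *\<^sub>R \<omega> + sin (pi * s / l) *\<^sub>R u,
      - sin (pi * s / l) * (pi / l) * a))"

lemma polar_has_derivative: "(polar l has_derivative polar' l s \<omega>) (at (s, \<omega>))"
proof -
  have "((\<lambda>p. (sin (pi * fst p / l) *\<^sub>R snd p, cos (pi * fst p / l))) has_derivative
      (\<lambda>h. (sin (pi * fst (s, \<omega>) / l) *\<^sub>R snd h + (fst h * pi / l * cos (pi * fst (s, \<omega>) / l)) *\<^sub>R snd (s, \<omega>),
         - (fst h * pi / l * sin (pi * fst (s, \<omega>) / l))))) (at (s, \<omega>))"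
    unfolding divide_inverse
    by (rule derivative_eq_intros refl ext | simp)+
  then show ?thesis
    by (simp add: polar_def polar'_def case_prod_unfold add.commute mult_ac)
qed

lemma frechet_polar: "frechet_derivative (polar l) (at (s, \<omega>)) = polar' l s \<omega>"
  by (rule frechet_derivative_at[OF polar_has_derivative, symmetric])

section \<open>Charts adapted to the metric\<close>

text \<open>The map \<open>Q\<close> will be an orthogonal transformation; it moves the centre of the coordinates to a prescribed
point of the 2-sphere.\<close>

definition chart :: "real \<Rightarrow> (real^3 \<Rightarrow> real^3) \<Rightarrow> real^3 \<Rightarrow> pt" where
  "chart l Q x = polar l (x$1, Q (geo x))"

definition chart_dom :: "real \<Rightarrow> (real^3) set" where
  "chart_dom l = {x. x$1 \<in> {0<..<l} \<and> x$2 \<in> {-pi/2<..<pi/2} \<and> x$3 \<in> {-pi/2<..<pi/2}}"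

lemma chart_has_derivative:
  assumes "linear Q"
  shows "(chart l Q has_derivative (\<lambda>v. polar' l (x$1) (Q (geo x)) (v$1, Q (geo' x v)))) (at x)"
proof -
  have Q: "bounded_linear Q" using assms by (simp add: linear_linear)
  have "((\<lambda>x. (x$1, Q (geo x))) has_derivative (\<lambda>v. (v$1, Q (geo' x v)))) (at x)"
    by (intro derivative_intros bounded_linear.has_derivative[OF Q] geo_has_derivative)
  from diff_chain_at[OF this polar_has_derivative]
  show ?thesis unfolding chart_def[abs_def] by (simp add: o_def)
qed

lemma pd_chart:
  assumes "linear Q"
  shows "pd i (chart l Q) x = polar' l (x$1) (Q (geo x)) (axis i 1 $ 1, Q (geo' x (axis i 1)))"
  unfolding pd_def frechet_derivative_at[OF chart_has_derivative[OF assms], symmetric] ..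

lemma chart_smooth:
  assumes "linear Q" shows "Ck_on k UNIV (chart l Q)"
proof -
  have b: "bounded_linear (\<lambda>x::real^3. pi * x$1 / l)"
  proof -
    have "(\<lambda>x::real^3. pi * x$1 / l) = (\<lambda>x. (pi / l) *\<^sub>R (x$1))" by auto
    then show ?thesis
      by (simp only:) (rule bounded_linear_compose[OF bounded_linear_scaleR_right bounded_linear_vec_nth])
  qed
  interpret linear Q by fact
  have "chart l Q = (\<lambda>x. sin (pi * x$1 / l) *\<^sub>R
      (cos (x$2) *\<^sub>R (cos (x$3) *\<^sub>R (Q (axis 1 1), 0) + sin (x$3) *\<^sub>R (Q (axis 2 1), 0))
        + sin (x$2) *\<^sub>R (Q (axis 3 1), 0)) + cos (pi * x$1 / l) *\<^sub>R (0, 1))"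
    by (rule ext) (simp add: chart_def polar_def geo_def add scaleR algebra_simps)
  then show ?thesis
    by (simp only:) (intro Ck_on_add Ck_on_scaleR Ck_on_sin_cos Ck_on_const b bounded_linear_vec_nth)
qed

lemma orthogonal_inner: "orthogonal_transformation Q \<Longrightarrow> Q v \<bullet> Q w = v \<bullet> w"
  by (simp add: orthogonal_transformation_def)

text \<open>The image of a coordinate vector is tangent to the 2-sphere, so the condition in \<open>rot_sym_metric\<close>
applies to it, and \<open>Q\<close> drops out because it preserves inner products.\<close>

lemma metric_coeff_chart:
  assumes rs: "rot_sym_metric l f g" and Q: "orthogonal_transformation Q" and x: "x \<in> chart_dom l"
  shows "metric_coeff g (chart l Q) x $ i $ j
     = (if i = j then (if i = 1 then 1 else if i = 2 then (f (x$1))\<^sup>2 else (f (x$1))\<^sup>2 * (cos (x$2))\<^sup>2) else 0)"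
proof -
  have lQ: "linear Q" using Q by (simp add: orthogonal_transformation_def)
  have n: "norm (Q (geo x)) = 1"
    using geo_inner[of x] by (simp add: norm_eq_sqrt_inner orthogonal_inner[OF Q])
  have perp: "Q (geo' x v) \<bullet> Q (geo x) = 0" for v
    by (simp add: orthogonal_inner[OF Q] geo'_inner_geo)
  have "g (polar l (x$1, Q (geo x))) (polar' l (x$1) (Q (geo x)) (a, u)) (polar' l (x$1) (Q (geo x)) (b, v))
      = a * b + (f (x$1))\<^sup>2 * (u \<bullet> v)" if "u \<bullet> Q (geo x) = 0" "v \<bullet> Q (geo x) = 0" for a b u v
  proof -
    have "x$1 \<in> {0<..<l}" "Q (geo x) \<in> sphere 0 1" using x n by (auto simp: chart_dom_def)
    then show ?thesis
      using rs that unfolding rot_sym_metric_def frechet_polar by blast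
  qed
  from this[OF perp perp] have "metric_coeff g (chart l Q) x $ i $ j
      = (axis i 1 :: real^3) $ 1 * (axis j 1 :: real^3) $ 1 + (f (x$1))\<^sup>2 * (geo' x (axis i 1) \<bullet> geo' x (axis j 1))"
    by (simp only: metric_coeff_def pd_chart[OF lQ] chart_def vec_lambda_beta orthogonal_inner[OF Q])
  also have "\<dots> = (if i = j then (if i = 1 then 1 else if i = 2 then (f (x$1))\<^sup>2 else (f (x$1))\<^sup>2 * (cos (x$2))\<^sup>2) else 0)"
  proof -
    consider "i = 1" | "i = 2" | "i = 3" using exhaust_3[of i] by blast
    moreover consider "j = 1" | "j = 2" | "j = 3" using exhaust_3[of j] by blast
    ultimately show ?thesis
      by cases (auto simp: geo'_inner_geo' axis_def)
  qed
  finally show ?thesis .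
qed

section \<open>Geographic coordinates are charts\<close>

text \<open>The distance from the pole is read off from the last component of the point; latitude and longitude come
from the direction of the remaining three, after the rotation is undone by \<open>P\<close>. Longitude is an arctangent, which
is why \<open>chart_dom\<close> restricts it to half a turn.\<close>

definition chart_inv :: "real \<Rightarrow> (real^3 \<Rightarrow> real^3) \<Rightarrow> pt \<Rightarrow> real^3" where
  "chart_inv l P p = (l / pi * arccos (snd p)) *\<^sub>R axis 1 1
     + arcsin (P (fst p) $ 3 / norm (fst p)) *\<^sub>R axis 2 1
     + arctan (P (fst p) $ 2 / P (fst p) $ 1) *\<^sub>R axis 3 1"

lemma chart_inv_nth [simp]:
  "chart_inv l P p $ 1 = l / pi * arccos (snd p)"
  "chart_inv l P p $ 2 = arcsin (P (fst p) $ 3 / norm (fst p))"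
  "chart_inv l P p $ 3 = arctan (P (fst p) $ 2 / P (fst p) $ 1)"
  by (simp_all add: chart_inv_def axis_def)

text \<open>A half-space; on the open hemisphere that it cuts out of the 3-sphere, \<open>chart_inv\<close> is continuous and
inverts the chart.\<close>

definition hemi :: "(real^3 \<Rightarrow> real^3) \<Rightarrow> pt set" where
  "hemi P = {p. P (fst p) $ 1 > 0}"

lemma vec3_eqI: "x$1 = y$1 \<Longrightarrow> x$2 = y$2 \<Longrightarrow> x$3 = y$3 \<Longrightarrow> x = (y::'a^3)"
  by (simp add: vec_eq_iff forall_3)

lemma norm_Pair_sq: "(norm p)\<^sup>2 = (norm (fst p))\<^sup>2 + (norm (snd p))\<^sup>2" for p :: pt
  by (simp add: norm_prod_def)

lemma sin_chart_pos: "0 < s \<Longrightarrow> s < l \<Longrightarrow> 0 < sin (pi * s / l)" for s l :: real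
  by (rule sin_gt_zero) (auto simp: field_simps)

lemma polar_in_S3: "norm \<omega> = 1 \<Longrightarrow> polar l (s, \<omega>) \<in> S3"
proof -
  assume "norm \<omega> = 1"
  then have "(norm (polar l (s, \<omega>)))\<^sup>2 = 1"
    by (simp add: norm_Pair_sq polar_def power_mult_distrib)
  then show ?thesis by (metis S3_def abs_norm_cancel abs_square_eq_1 mem_sphere_0)
qed

text \<open>An orthogonal transformation \<open>Q\<close> together with its inverse \<open>P\<close>.\<close>

locale frame =
  fixes Q P :: "real^3 \<Rightarrow> real^3"
  assumes Q: "orthogonal_transformation Q"
    and P: "orthogonal_transformation P"
    and PQ: "P (Q v) = v" and QP: "Q (P v) = v"
begin

lemma linear_Q: "linear Q" and linear_P: "linear P"
  using Q P by (auto simp: orthogonal_transformation_def)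

lemma norm_Q [simp]: "norm (Q v) = norm v"
  using Q by (simp add: orthogonal_transformation)

lemma norm_P [simp]: "norm (P v) = norm v"
  using P by (simp add: orthogonal_transformation)

lemma norm_geo [simp]: "norm (geo x) = 1"
  by (simp add: norm_eq_sqrt_inner geo_inner)

lemma chart_in:
  assumes "x \<in> chart_dom l"
  shows "chart l Q x \<in> S3 \<inter> hemi P" "chart_inv l P (chart l Q x) = x"
proof -
  have x: "0 < x$1" "x$1 < l" "-pi/2 < x$2" "x$2 < pi/2" "-pi/2 < x$3" "x$3 < pi/2"
    using assms by (auto simp: chart_dom_def)
  have s: "0 < sin (pi * x$1 / l)" by (rule sin_chart_pos) (use x in auto)
  have c: "0 < cos (x$2)" "0 < cos (x$3)" using x by (auto intro!: cos_gt_zero_pi)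
  have w: "P (fst (chart l Q x)) = sin (pi * x$1 / l) *\<^sub>R geo x"
    by (simp add: chart_def polar_def linear_scale[OF linear_P] PQ)
  have n: "norm (fst (chart l Q x)) = sin (pi * x$1 / l)"
    using s by (simp add: chart_def polar_def)
  show "chart l Q x \<in> S3 \<inter> hemi P"
    using s c w by (auto simp: hemi_def chart_def intro: polar_in_S3)
  have a: "arccos (cos (pi * x$1 / l)) = pi * x$1 / l"
    using x by (intro arccos_cos) (auto simp: field_simps)
  show "chart_inv l P (chart l Q x) = x"
  proof (rule vec3_eqI)
    show "chart_inv l P (chart l Q x) $ 1 = x $ 1"
      using x by (simp add: chart_def polar_def a)
    have "chart_inv l P (chart l Q x) $ 2 = arcsin (sin (x$2))"
      using s by (simp add: w n)
    also have "\<dots> = x$2" using x by (intro arcsin_sin) auto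
    finally show "chart_inv l P (chart l Q x) $ 2 = x $ 2" .
    have "chart_inv l P (chart l Q x) $ 3 = arctan (tan (x$3))"
      using s c by (simp add: w tan_def)
    also have "\<dots> = x$3" using x by (intro arctan_tan) auto
    finally show "chart_inv l P (chart l Q x) $ 3 = x $ 3" .
  qed
qed

lemma cos_arctan_div:
  fixes a b :: real assumes "a > 0"
  shows "cos (arctan (b / a)) = a / sqrt (a\<^sup>2 + b\<^sup>2)" "sin (arctan (b / a)) = b / sqrt (a\<^sup>2 + b\<^sup>2)"
proof -
  have "1 + (b/a)\<^sup>2 = (a\<^sup>2 + b\<^sup>2) / a\<^sup>2" using assms by (simp add: field_simps)
  then have "sqrt (1 + (b/a)\<^sup>2) = sqrt (a\<^sup>2 + b\<^sup>2) / a"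
    using assms by (simp add: real_sqrt_divide)
  then show "cos (arctan (b / a)) = a / sqrt (a\<^sup>2 + b\<^sup>2)" "sin (arctan (b / a)) = b / sqrt (a\<^sup>2 + b\<^sup>2)"
    using assms by (simp_all add: cos_arctan sin_arctan)
qed

text \<open>Write \<open>p = (v, c)\<close>, \<open>r = norm v\<close> and \<open>w = P v\<close>. On the unit 3-sphere \<open>r = sin (arccos c)\<close>, and \<open>w / r\<close> is a unit
vector with positive first component; its latitude is \<open>arcsin (w$3 / r)\<close>, and its longitude lies within a
quarter turn of \<open>0\<close>.\<close>

lemma chart_chart_inv:
  assumes "p \<in> S3 \<inter> hemi P" and l: "l > 0"
  shows "chart_inv l P p \<in> chart_dom l" "chart l Q (chart_inv l P p) = p"
proof -
  define r where "r = norm (fst p)"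
  define w where "w = P (fst p)"
  define c where "c = snd p"
  have w1: "w$1 > 0" using assms by (simp add: hemi_def w_def)
  have nw: "norm w = r" by (simp add: w_def r_def)
  then have w2: "(w$1)\<^sup>2 + (w$2)\<^sup>2 + (w$3)\<^sup>2 = r\<^sup>2"
    by (metis dot_square_norm inner_3 power2_eq_square)
  have "w \<noteq> 0" using w1 by auto
  then have r: "r > 0" using nw by auto
  have rc: "r\<^sup>2 + c\<^sup>2 = 1"
    using assms norm_Pair_sq[of p] by (simp add: S3_def r_def c_def)
  then have c2: "1 - c\<^sup>2 = r\<^sup>2" by simp
  then have "c\<^sup>2 < 1" using r by (metis diff_gt_0_iff_gt zero_less_power)
  then have c: "-1 < c" "c < 1"
    using abs_square_less_1[of c] r by (simp_all add: abs_less_iff)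
  have sac: "sin (arccos c) = r" using c r c2 by (simp add: sin_arccos)
  have "(w$3)\<^sup>2 < r\<^sup>2" using w2 zero_less_power[OF w1, of 2] zero_le_power2[of "w$2"] by linarith
  then have w3: "\<bar>w$3\<bar> < r" using r by (intro power_less_imp_less_base[of "\<bar>w$3\<bar>" 2 r]) auto
  then have w3': "-1 < w$3 / r" "w$3 / r < 1" using r by (auto simp: field_simps)
  have ac: "0 < arccos c" "arccos c < pi" using c arccos_lt_bounded by auto
  show "chart_inv l P p \<in> chart_dom l"
    using l ac w3' arcsin_lt_bounded[OF w3'] arctan_bounded[of "w$2 / w$1"]
    unfolding chart_dom_def by (simp add: field_simps flip: w_def r_def c_def)
  have "1 - (w$3 / r)\<^sup>2 = ((w$1)\<^sup>2 + (w$2)\<^sup>2) / r\<^sup>2"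
    using r w2 by (simp add: field_simps)
  then have cas: "cos (arcsin (w$3 / r)) = sqrt ((w$1)\<^sup>2 + (w$2)\<^sup>2) / r"
    using r w3' by (simp add: cos_arcsin real_sqrt_divide)
  have pos: "sqrt ((w$1)\<^sup>2 + (w$2)\<^sup>2) > 0" using w1 by (simp add: add_pos_nonneg)
  have g: "geo (chart_inv l P p) = (1 / r) *\<^sub>R w"
    using w3' pos r
    by (intro vec3_eqI) (simp_all add: cas cos_arctan_div[OF w1] flip: w_def r_def)
  have "r *\<^sub>R Q (geo (chart_inv l P p)) = fst p"
    unfolding g linear_scale[OF linear_Q] using r by (simp add: w_def QP)
  moreover have "pi * (chart_inv l P p $ 1) / l = arccos c"
    using l by (simp add: c_def)
  moreover have "cos (arccos c) = c" using c by simp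
  ultimately show "chart l Q (chart_inv l P p) = p"
    unfolding chart_def polar_def case_prod_conv by (simp only: sac) (simp add: c_def)
qed

lemma chart_image:
  assumes "l > 0" shows "chart l Q ` chart_dom l = S3 \<inter> hemi P"
proof (intro equalityI subsetI)
  fix p assume "p \<in> S3 \<inter> hemi P"
  from chart_chart_inv[OF this assms] show "p \<in> chart l Q ` chart_dom l"
    by (metis image_eqI)
qed (use chart_in(1) in blast)

lemma chart_inv_image:
  assumes "l > 0" shows "chart_inv l P ` (S3 \<inter> hemi P) = chart_dom l"
proof (intro equalityI subsetI)
  fix x assume x: "x \<in> chart_dom l"
  show "x \<in> chart_inv l P ` (S3 \<inter> hemi P)"
    using chart_in(1)[OF x] chart_in(2)[OF x] by (metis image_eqI)
qed (use chart_chart_inv(1)[OF _ assms] in blast)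

lemma continuous_P [continuous_intros]: "continuous_on S h \<Longrightarrow> continuous_on S (\<lambda>x. P (h x))"
  using bounded_linear.continuous_on linear_P linear_linear by blast

lemma open_hemi: "open (hemi P)"
  unfolding hemi_def by (intro open_Collect_less continuous_intros)

lemma continuous_chart_inv: "continuous_on (S3 \<inter> hemi P) (chart_inv l P)"
proof -
  have nz: "P (fst p) $ 1 \<noteq> 0" "norm (fst p) \<noteq> 0" if "p \<in> S3 \<inter> hemi P" for p
    using that linear_0[OF linear_P] by (auto simp: hemi_def)
  have le: "\<bar>snd p\<bar> \<le> 1" if "p \<in> S3 \<inter> hemi P" for p
    using that norm_snd_le[of "snd p" "fst p"] by (simp add: S3_def)
  have "\<bar>P (fst p) $ 3\<bar> \<le> norm (fst p)" for p
    using component_le_norm_cart[of "P (fst p)" 3] by simp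
  then have le': "\<bar>P (fst p) $ 3 / norm (fst p)\<bar> \<le> 1" if "p \<in> S3 \<inter> hemi P" for p
    using nz[OF that] by (simp add: abs_divide divide_le_eq)
  show ?thesis
    unfolding chart_inv_def
    using nz abs_le_iff[THEN iffD1, OF le] abs_le_iff[THEN iffD1, OF le']
    by (intro continuous_intros) (auto simp: abs_le_iff minus_le_iff)
qed

lemma continuous_chart: "continuous_on S (chart l Q)"
  using chart_has_derivative[OF linear_Q]
  by (meson continuous_at_imp_continuous_on has_derivative_continuous)

text \<open>The last component of \<open>polar'\<close> determines the radial part because \<open>sin (pi * s / l)\<close> does not vanish, and the
round metric, positive definite away from the poles of the 2-sphere, determines the rest.\<close>

lemma inj_deriv_chart:
  assumes x: "x \<in> chart_dom l"
  shows "inj (frechet_derivative (chart l Q) (at x))"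
proof -
  let ?d = "frechet_derivative (chart l Q) (at x)"
  have d: "?d = (\<lambda>v. polar' l (x$1) (Q (geo x)) (v$1, Q (geo' x v)))"
    by (rule frechet_derivative_at[OF chart_has_derivative[OF linear_Q], symmetric])
  have x': "0 < x$1" "x$1 < l" "cos (x$2) \<noteq> 0"
    using x cos_gt_zero_pi[of "x$2"] by (auto simp: chart_dom_def)
  have s: "0 < sin (pi * x$1 / l)" by (rule sin_chart_pos) (use x' in auto)
  have "linear ?d" unfolding d
    using has_derivative_linear[OF chart_has_derivative[OF linear_Q]] .
  moreover have "v = 0" if "?d v = 0" for v
  proof -
    have v1: "v$1 = 0"
      using that s x' by (simp add: d polar'_def prod_eq_iff)
    have "Q (geo' x v) = 0"
      using that s v1 by (simp add: d polar'_def prod_eq_iff)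
    then have "norm (geo' x v) = 0" by (metis norm_Q norm_zero)
    then have "v$2 * v$2 + (cos (x$2))\<^sup>2 * (v$3 * v$3) = 0"
      using geo'_inner_geo'[of x v v] by simp
    then have "v$2 = 0" "cos (x$2) * v$3 = 0"
      by (simp_all add: power2_eq_square[symmetric] power_mult_distrib[symmetric])
    then show "v = 0" using v1 x' by (intro vec3_eqI) auto
  qed
  ultimately show ?thesis by (simp add: linear_injective_0)
qed

lemma open_chart_dom: "open (chart_dom l)"
  unfolding chart_dom_def greaterThanLessThan_iff
  by (intro open_Collect_conj open_Collect_less continuous_intros)

lemma local_param_chart:
  assumes "l > 0" shows "local_param (chart l Q) (chart_dom l) S3"
  unfolding local_param_def
proof (intro conjI ballI)
  show "openin (top_of_set S3) (chart l Q ` chart_dom l)"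
    unfolding chart_image[OF assms] by (simp add: open_hemi openin_open_Int)
  show "\<exists>\<psi>. homeomorphism (chart_dom l) (chart l Q ` chart_dom l) (chart l Q) \<psi>"
    unfolding chart_image[OF assms]
    using chart_image[OF assms] chart_inv_image[OF assms] chart_in(2) chart_chart_inv(2)[OF _ assms]
    by (auto simp: homeomorphism_def intro!: exI[of _ "chart_inv l P"] continuous_chart continuous_chart_inv)
qed (use open_chart_dom inj_deriv_chart chart_smooth[OF linear_Q] in \<open>auto intro: smooth_on_if_Ck\<close>)

end

section \<open>Scalar curvature\<close>

text \<open>The components of the metric and the Christoffel symbols are all products of a function of \<open>s\<close> and a
function of \<open>\<theta>\<close>, so this is the only differentiation rule that the curvature computation uses.\<close>

lemma pd_separated:
  fixes h :: "real^3 \<Rightarrow> real"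
  assumes U: "open U" "x \<in> U" and h: "\<And>y. y \<in> U \<Longrightarrow> h y = a (y$1) * b (y$2)"
    and a: "(a has_real_derivative a') (at (x$1))" and b: "(b has_real_derivative b') (at (x$2))"
  shows "pd k h x = (if k = 1 then a' * b (x$2) else if k = 2 then a (x$1) * b' else 0)"
proof -
  have "((\<lambda>y::real^3. a (y$1) * b (y$2)) has_derivative
      (\<lambda>v. a (x$1) * (v$2 * b') + v$1 * a' * b (x$2))) (at x)"
    by (intro has_derivative_mult DERIV_compose_FDERIV[where f = a and g = "\<lambda>y. y$1" and x = x, OF a]
        DERIV_compose_FDERIV[where f = b and g = "\<lambda>y. y$2" and x = x, OF b]
        bounded_linear_imp_has_derivative bounded_linear_vec_nth)
  then have "(h has_derivative (\<lambda>v. a (x$1) * (v$2 * b') + v$1 * a' * b (x$2))) (at x)"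
    by (rule has_derivative_transform_within_open[OF _ U]) (simp add: h)
  from frechet_derivative_at[OF this, symmetric]
  have "pd k h x = a (x$1) * (axis k 1 $ 2 * b') + axis k 1 $ 1 * a' * b (x$2)"
    by (simp add: pd_def)
  then show ?thesis using exhaust_3[of k] by (auto simp: axis_def)
qed

lemma matrix_inv_diagonal:
  fixes M :: "real^'n^'n"
  assumes M: "\<And>i j. M $ i $ j = (if i = j then d i else 0)" and d: "\<And>i. d i \<noteq> 0"
  shows "matrix_inv M $ i $ j = (if i = j then 1 / d i else 0)"
proof -
  let ?N = "(\<chi> i j. if i = j then 1 / d i else 0) :: real^'n^'n"
  have "M ** ?N = mat 1" "?N ** M = mat 1"
  proof -
    have "M $ i $ k * ?N $ k $ j = (if k = i then (if i = j then 1 else 0) else 0)"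
      "?N $ i $ k * M $ k $ j = (if k = i then (if i = j then 1 else 0) else 0)" for i j k
      using d by (auto simp: M)
    then show "M ** ?N = mat 1" "?N ** M = mat 1"
      by (simp_all add: matrix_matrix_mult_def mat_def)
  qed
  moreover from this have "M ** matrix_inv M = mat 1 \<and> matrix_inv M ** M = mat 1"
    unfolding matrix_inv_def by (intro someI[of "\<lambda>A. M ** A = mat 1 \<and> A ** M = mat 1"]) simp
  ultimately have "?N ** M ** matrix_inv M = matrix_inv M" "?N ** (M ** matrix_inv M) = ?N"
    by (simp_all only: matrix_mul_lid matrix_mul_rid)
  then have "matrix_inv M = ?N"
    by (simp only: matrix_mul_assoc)
  then show ?thesis by simp
qed

text \<open>The Christoffel symbols of \<open>ds\<^sup>2 + f(s)\<^sup>2 (d\<theta>\<^sup>2 + cos\<^sup>2 \<theta> d\<phi>\<^sup>2)\<close> are products of a function of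
  \<open>s\<close> and a function of \<open>\<theta>\<close>, given here with their derivatives.\<close>

definition chr_s :: "(real \<Rightarrow> real) \<Rightarrow> (real \<Rightarrow> real) \<Rightarrow> 3 \<Rightarrow> 3 \<Rightarrow> 3 \<Rightarrow> real \<Rightarrow> real" where
  "chr_s f f' k i j s =
    (if k = 1 then - f s * f' s
     else if i = 1 \<or> j = 1 then f' s / f s else 1)"

definition chr_\<theta> :: "3 \<Rightarrow> 3 \<Rightarrow> 3 \<Rightarrow> real \<Rightarrow> real" where
  "chr_\<theta> k i j t =
    (if k = 1 then (if i = 2 \<and> j = 2 then 1 else if i = 3 \<and> j = 3 then (cos t)\<^sup>2 else 0)
     else if k = 2 then (if i = 1 \<and> j = 2 \<or> i = 2 \<and> j = 1 then 1
       else if i = 3 \<and> j = 3 then cos t * sin t else 0)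
     else (if i = 1 \<and> j = 3 \<or> i = 3 \<and> j = 1 then 1
       else if i = 2 \<and> j = 3 \<or> i = 3 \<and> j = 2 then - tan t else 0))"

definition chr_s' :: "(real \<Rightarrow> real) \<Rightarrow> (real \<Rightarrow> real) \<Rightarrow> (real \<Rightarrow> real) \<Rightarrow> 3 \<Rightarrow> 3 \<Rightarrow> 3 \<Rightarrow> real \<Rightarrow> real" where
  "chr_s' f f' f'' k i j s =
    (if k = 1 then - (f' s * f' s + f s * f'' s)
     else if i = 1 \<or> j = 1 then (f'' s * f s - f' s * f' s) / (f s * f s) else 0)"

definition chr_\<theta>' :: "3 \<Rightarrow> 3 \<Rightarrow> 3 \<Rightarrow> real \<Rightarrow> real" where
  "chr_\<theta>' k i j t =
    (if k = 1 then (if i = 3 \<and> j = 3 then - 2 * cos t * sin t else 0)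
     else if k = 2 then (if i = 3 \<and> j = 3 then cos t * cos t - sin t * sin t else 0)
     else (if i = 2 \<and> j = 3 \<or> i = 3 \<and> j = 2 then - 1 / (cos t)\<^sup>2 else 0))"

lemma chr_s_deriv:
  assumes "(f has_real_derivative f' s) (at s)" "(f' has_real_derivative f'' s) (at s)" "f s \<noteq> 0"
  shows "(chr_s f f' k i j has_real_derivative chr_s' f f' f'' k i j s) (at s)"
  using assms unfolding chr_s_def[abs_def] chr_s'_def
  by (auto intro!: derivative_eq_intros simp: field_simps)

lemma chr_\<theta>_deriv:
  assumes "cos t \<noteq> 0"
  shows "(chr_\<theta> k i j has_real_derivative chr_\<theta>' k i j t) (at t)"
proof -
  have "k = 1 \<or> k = 2 \<or> k = 3" "i = 1 \<or> i = 2 \<or> i = 3" "j = 1 \<or> j = 2 \<or> j = 3"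
    using exhaust_3 by blast+
  then show ?thesis
    using assms unfolding chr_\<theta>_def[abs_def] chr_\<theta>'_def
    by (elim disjE) (auto intro!: derivative_eq_intros simp: divide_inverse power2_eq_square)
qed

text \<open>The derivatives of the warping function are parameters of the locale, so that the curvature formulas can
name them.\<close>

locale rot_sym = frame +
  fixes l :: real and f f' f'' :: "real \<Rightarrow> real" and g :: metric
  assumes rs: "rot_sym_metric l f g" and l_pos: "l > 0"
    and f_pos: "\<And>s. 0 < s \<Longrightarrow> s < l \<Longrightarrow> f s > 0"
    and f_deriv: "\<And>s. 0 < s \<Longrightarrow> s < l \<Longrightarrow> (f has_real_derivative f' s) (at s)"
    and f_deriv2: "\<And>s. 0 < s \<Longrightarrow> s < l \<Longrightarrow> (f' has_real_derivative f'' s) (at s)"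
begin

abbreviation "G \<equiv> metric_coeff g (chart l Q)"

lemma chart_domD:
  assumes "x \<in> chart_dom l"
  shows "0 < x$1" "x$1 < l" "cos (x$2) > 0" "f (x$1) > 0"
  using assms by (auto simp: chart_dom_def intro!: cos_gt_zero_pi f_pos)

lemma inv_G:
  assumes "x \<in> chart_dom l"
  shows "matrix_inv (G x) $ i $ j = (if i = j then
     1 / (if i = 1 then 1 else if i = 2 then (f (x$1))\<^sup>2 else (f (x$1))\<^sup>2 * (cos (x$2))\<^sup>2) else 0)"
  by (rule matrix_inv_diagonal[OF metric_coeff_chart[OF rs Q assms]])
    (use chart_domD[OF assms] in auto)

lemma pd_G:
  assumes "x \<in> chart_dom l"
  shows "pd k (\<lambda>y. G y $ i $ j) x = (if i = j then
    (if i = 1 then 0 else if i = 2 then (if k = 1 then 2 * f (x$1) * f' (x$1) else 0)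
     else (if k = 1 then 2 * f (x$1) * f' (x$1) * (cos (x$2))\<^sup>2
       else if k = 2 then - (f (x$1))\<^sup>2 * (2 * cos (x$2) * sin (x$2)) else 0)) else 0)"
proof -
  let ?a = "\<lambda>s. if i = j then (if i = 1 then 1 else (f s)\<^sup>2) else 0"
  let ?b = "\<lambda>t::real. if i = 3 then (cos t)\<^sup>2 else 1"
  let ?a' = "if i = j then (if i = 1 then 0 else 2 * f (x$1) * f' (x$1)) else 0"
  let ?b' = "if i = 3 then - 2 * cos (x$2) * sin (x$2) else 0"
  have 1: "(?a has_real_derivative ?a') (at (x$1))"
    using chart_domD[OF assms] by (auto intro!: derivative_eq_intros f_deriv)
  have 2: "(?b has_real_derivative ?b') (at (x$2))"
    by (auto intro!: derivative_eq_intros)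
  have 3: "G y $ i $ j = ?a (y$1) * ?b (y$2)" if "y \<in> chart_dom l" for y
    using exhaust_3[of i] by (auto simp: metric_coeff_chart[OF rs Q that])
  have "pd k (\<lambda>y. G y $ i $ j) x
      = (if k = 1 then ?a' * ?b (x$2) else if k = 2 then ?a (x$1) * ?b' else 0)"
    by (rule pd_separated[where a = ?a and b = ?b, OF open_chart_dom assms 3 1 2])
  moreover have "k = 1 \<or> k = 2 \<or> k = 3" "i = 1 \<or> i = 2 \<or> i = 3" "j = 1 \<or> j = 2 \<or> j = 3"
    using exhaust_3 by blast+
  ultimately show ?thesis
    by (elim disjE) simp_all
qed

lemma christoffel_G:
  assumes "x \<in> chart_dom l"
  shows "christoffel G k i j x = chr_s f f' k i j (x$1) * chr_\<theta> k i j (x$2)"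
proof -
  note [simp] = inv_G[OF assms] pd_G[OF assms] chr_s_def chr_\<theta>_def tan_def power2_eq_square
  have "cos (x$2) \<noteq> 0" "f (x$1) \<noteq> 0" using chart_domD[OF assms] by auto
  moreover have "k = 1 \<or> k = 2 \<or> k = 3" "i = 1 \<or> i = 2 \<or> i = 3" "j = 1 \<or> j = 2 \<or> j = 3"
    using exhaust_3 by blast+
  ultimately show ?thesis
    by (elim disjE) (simp_all add: christoffel_def sum_3)
qed

lemma pd_christoffel_G:
  assumes "x \<in> chart_dom l"
  shows "pd m (christoffel G k i j) x =
    (if m = 1 then chr_s' f f' f'' k i j (x$1) * chr_\<theta> k i j (x$2)
     else if m = 2 then chr_s f f' k i j (x$1) * chr_\<theta>' k i j (x$2) else 0)"
  using chart_domD[OF assms]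
  by (intro pd_separated[where a = "chr_s f f' k i j" and b = "chr_\<theta> k i j", OF open_chart_dom assms] christoffel_G chr_s_deriv chr_\<theta>_deriv f_deriv f_deriv2) auto

text \<open>The scalar curvature depends on \<open>s\<close> only, so it is evaluated at \<open>\<theta> = \<phi> = 0\<close>, where the sines and tangents
vanish. The diagonal entries of the Ricci tensor are there \<open>- 2 f'' / f\<close> and, twice,
\<open>1 - f'\<^sup>2 - f f''\<close>.\<close>

lemma scal_chart:
  assumes s: "0 < s" "s < l"
  shows "scal G (s *\<^sub>R axis 1 1) = - 4 * f'' s / f s + 2 * (1 - (f' s)\<^sup>2) / (f s)\<^sup>2"
proof -
  let ?x = "s *\<^sub>R axis 1 1 :: real^3"
  have x: "?x \<in> chart_dom l" and [simp]: "?x $ 1 = s" "?x $ 2 = 0" "?x $ 3 = 0"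
    using s by (auto simp: chart_dom_def axis_def)
  have [simp]: "axis 1 1 $ (2::3) = (0::real)" "axis 1 1 $ (3::3) = (0::real)" "axis 1 1 $ (1::3) = (1::real)"
    by (simp_all add: axis_def)
  note [simp] = chr_s_def chr_\<theta>_def chr_s'_def chr_\<theta>'_def christoffel_G[OF x] pd_christoffel_G[OF x]
  have f: "f s > 0" using f_pos s by auto
  have "ricci G 1 1 ?x = - 2 * f'' s / f s"
    using f by (simp add: ricci_def sum_3 field_simps)
  moreover have "ricci G 2 2 ?x = 1 - (f' s)\<^sup>2 - f s * f'' s"
    using f by (simp add: ricci_def sum_3 field_simps power2_eq_square)
  moreover have "ricci G 3 3 ?x = 1 - (f' s)\<^sup>2 - f s * f'' s"
    using f by (simp add: ricci_def sum_3 field_simps power2_eq_square)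
  moreover have "scal G ?x = ricci G 1 1 ?x + ricci G 2 2 ?x / (f s)\<^sup>2 + ricci G 3 3 ?x / (f s)\<^sup>2"
    by (simp add: scal_def sum_3 inv_G[OF x])
  ultimately have "scal G ?x = - 2 * f'' s / f s + (1 - (f' s)\<^sup>2 - f s * f'' s) / (f s)\<^sup>2
      + (1 - (f' s)\<^sup>2 - f s * f'' s) / (f s)\<^sup>2"
    by simp
  also have "\<dots> = - 4 * f'' s / f s + 2 * (1 - (f' s)\<^sup>2) / (f s)\<^sup>2"
    using f by (simp add: field_simps power2_eq_square)
  finally show ?thesis .
qed

lemma scalar_curvature_ineq:
  assumes "nonneg_scalar_curvature g" and s: "0 < s" "s < l"
  shows "2 * f s * f'' s \<le> 1 - (f' s)\<^sup>2"
proof -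
  let ?x = "s *\<^sub>R axis 1 1 :: real^3"
  have x: "?x \<in> chart_dom l"
    using s by (auto simp: chart_dom_def axis_def)
  have "has_scalar_curvature g (chart l Q ?x) (scal G ?x)"
    using local_param_chart[OF l_pos] x unfolding has_scalar_curvature_def by blast
  moreover have "chart l Q ?x \<in> S3" using chart_in[OF x] by auto
  ultimately have "0 \<le> - 4 * f'' s / f s + 2 * (1 - (f' s)\<^sup>2) / (f s)\<^sup>2"
    using assms(1) scal_chart[OF s] unfolding nonneg_scalar_curvature_def by metis
  also have "\<dots> = 2 / (f s)\<^sup>2 * (1 - (f' s)\<^sup>2 - 2 * f s * f'' s)"
    using f_pos[OF s] by (simp add: field_simps power2_eq_square)
  finally have "0 \<le> 2 / (f s)\<^sup>2 * (1 - (f' s)\<^sup>2 - 2 * f s * f'' s)" .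
  moreover have "0 < 2 / (f s)\<^sup>2" using f_pos[OF s] by simp
  ultimately have "0 \<le> 1 - (f' s)\<^sup>2 - 2 * f s * f'' s"
    by (metis zero_le_mult_iff linorder_not_less)
  then show ?thesis by simp
qed

end

section \<open>Spheres of latitude\<close>

definition latitude :: "real \<Rightarrow> real \<Rightarrow> pt set" where
  "latitude l s = polar l ` ({s} \<times> sphere 0 1)"

definition slice :: "real \<Rightarrow> real^2 \<Rightarrow> real^3" where
  "slice s y = s *\<^sub>R axis 1 1 + (y$1 *\<^sub>R axis 2 1 + y$2 *\<^sub>R axis 3 1)"

definition slice_dom :: "(real^2) set" where
  "slice_dom = {y. y$1 \<in> {-pi/2<..<pi/2} \<and> y$2 \<in> {-pi/2<..<pi/2}}"

text \<open>The coordinate of the 3-sphere to which a coordinate of the surface corresponds.\<close>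

definition slice_index :: "2 \<Rightarrow> 3" where
  "slice_index a = (if a = 1 then 2 else 3)"

lemma slice_nth [simp]: "slice s y $ 1 = s" "slice s y $ 2 = y $ 1" "slice s y $ 3 = y $ 2"
  by (simp_all add: slice_def axis_def)

lemma slice_in_chart_dom: "0 < s \<Longrightarrow> s < l \<Longrightarrow> y \<in> slice_dom \<Longrightarrow> slice s y \<in> chart_dom l"
  by (simp add: chart_dom_def slice_dom_def)

lemma slice_has_derivative:
  "(slice s has_derivative (\<lambda>v. v$1 *\<^sub>R axis 2 1 + v$2 *\<^sub>R axis 3 1)) (at y)"
proof -
  have "(slice s has_derivative (\<lambda>v. 0 + (v$1 *\<^sub>R axis 2 1 + v$2 *\<^sub>R axis 3 1))) (at y)"
    unfolding slice_def[abs_def]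
    by (intro has_derivative_add has_derivative_const has_derivative_scaleR_left
        bounded_linear_imp_has_derivative bounded_linear_vec_nth)
  then show ?thesis by simp
qed

lemma frechet_slice: "frechet_derivative (slice s) (at y) = (\<lambda>v. v$1 *\<^sub>R axis 2 1 + v$2 *\<^sub>R axis 3 1)"
  by (rule frechet_derivative_at[OF slice_has_derivative, symmetric])

lemma pd_slice: "pd a (slice s) y = axis (slice_index a) 1"
  unfolding pd_def frechet_slice slice_index_def
  using exhaust_2[of a] by (auto simp: axis_def vec_eq_iff)

lemma slice_smooth: "Ck_on k UNIV (slice s)"
proof -
  have "bounded_linear (\<lambda>y::real^2. y$1 *\<^sub>R axis 2 1 + y$2 *\<^sub>R axis 3 1 :: real^3)"
    by (intro bounded_linear_add bounded_linear_scaleR_const bounded_linear_vec_nth)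
  then show ?thesis
    unfolding slice_def[abs_def] by (intro Ck_on_add Ck_on_const Ck_on_linear)
qed

lemma continuous_slice: "continuous_on S (slice s)"
  using slice_has_derivative by (meson continuous_at_imp_continuous_on has_derivative_continuous)

lemma open_slice_dom: "open slice_dom"
  unfolding slice_dom_def greaterThanLessThan_iff
  by (intro open_Collect_conj open_Collect_less continuous_intros)

lemma bounded_slice_dom: "bounded slice_dom"
proof (rule boundedI)
  fix y :: "real^2" assume "y \<in> slice_dom"
  then have "\<bar>y$1\<bar> \<le> pi / 2" "\<bar>y$2\<bar> \<le> pi / 2" by (auto simp: slice_dom_def)
  then show "norm y \<le> pi"
    using norm_le_l1_cart[of y] by (simp add: sum_2)
qed

lemma continuous_polar: "continuous_on S (polar l)"
proof (intro continuous_at_imp_continuous_on ballI)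
  fix p show "isCont (polar l) p"
    using has_derivative_continuous[OF polar_has_derivative[of l "fst p" "snd p"]] by simp
qed

lemma latitude_closed: "compact (latitude l s)" "connected (latitude l s)" "latitude l s \<noteq> {}"
  "latitude l s \<subseteq> S3"
proof -
  have "connected (sphere (0::real^3) 1)"
    by (rule connected_sphere) simp
  then show "connected (latitude l s)"
    unfolding latitude_def
    by (intro connected_continuous_image continuous_polar connected_Times connected_sing)
  show "compact (latitude l s)"
    unfolding latitude_def by (intro compact_continuous_image continuous_polar compact_Times) auto
  have "axis 1 1 \<in> sphere (0::real^3) 1" by simp
  then show "latitude l s \<noteq> {}" unfolding latitude_def by blast
  show "latitude l s \<subseteq> S3" by (auto simp: latitude_def intro: polar_in_S3)
qed

text \<open>Only \<open>Q\<close> has to be constructed, and orthogonal transformations act transitively on the unit sphere.\<close>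

lemma frame_exists:
  assumes "norm (\<omega> :: real^3) = 1"
  obtains Q P where "frame Q P" "Q (axis 1 1) = \<omega>"
proof -
  have n: "norm (axis 1 1 :: real^3) = 1" by simp
  have "\<exists>Q :: real^3 \<Rightarrow> real^3. orthogonal_transformation Q \<and> Q (axis 1 1) = \<omega>"
  proof (rule orthogonal_transformation_exists_1[OF n assms])
    fix f :: "real^3 \<Rightarrow> real^3" assume "orthogonal_transformation f" "f (axis 1 1) = \<omega>"
    then show ?thesis by (intro exI[of _ f] conjI)
  qed
  then obtain Q :: "real^3 \<Rightarrow> real^3" where Q: "orthogonal_transformation Q" "Q (axis 1 1) = \<omega>"
    by blast
  have "orthogonal_transformation (inv Q)" "inv Q (Q v) = v" "Q (inv Q v) = v" for v
    using orthogonal_transformation_inv[OF Q(1)] inv_f_f[OF orthogonal_transformation_inj[OF Q(1)]]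
      surj_f_inv_f[OF orthogonal_transformation_surj[OF Q(1)]] by auto
  then have "frame Q (inv Q)" using Q(1) by (intro frame.intro)
  then show ?thesis using Q(2) by (rule that)
qed

context frame begin

lemma hemi_eq: "hemi P = {p. 0 < fst p \<bullet> Q (axis 1 1)}"
proof -
  have "P v $ 1 = v \<bullet> Q (axis 1 1)" for v
    using orthogonal_inner[OF P, of v "Q (axis 1 1)"] by (simp add: PQ inner_axis)
  then show ?thesis by (simp add: hemi_def)
qed

lemma chart_slice_image:
  assumes "0 < s" "s < l"
  shows "(chart l Q \<circ> slice s) ` slice_dom = latitude l s \<inter> hemi P"
proof (intro equalityI subsetI)
  fix p assume "p \<in> (chart l Q \<circ> slice s) ` slice_dom"
  then obtain y where y: "y \<in> slice_dom" "p = chart l Q (slice s y)" by auto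
  have "p = polar l (s, Q (geo (slice s y)))" by (simp add: y chart_def)
  then have "p \<in> latitude l s"
    unfolding latitude_def by (rule image_eqI) simp
  then show "p \<in> latitude l s \<inter> hemi P"
    using chart_in(1)[OF slice_in_chart_dom[OF assms y(1)]] y(2) by simp
next
  fix p assume p: "p \<in> latitude l s \<inter> hemi P"
  define x where "x = chart_inv l P p"
  have "p \<in> S3 \<inter> hemi P" using p latitude_closed(4) by auto
  then have x: "x \<in> chart_dom l" "chart l Q x = p"
    using chart_chart_inv assms by (auto simp: x_def)
  have "snd p = cos (pi * s / l)" using p by (auto simp: latitude_def polar_def)
  moreover have "arccos (cos (pi * s / l)) = pi * s / l"
    using assms by (intro arccos_cos) (auto simp: field_simps)
  ultimately have "x $ 1 = s" using assms by (simp add: x_def)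
  define y :: "real^2" where "y = (x$2) *\<^sub>R axis 1 1 + (x$3) *\<^sub>R axis 2 1"
  have y12: "y$1 = x$2" "y$2 = x$3" by (simp_all add: y_def axis_def)
  have "slice s y = x" using y12 \<open>x $ 1 = s\<close> by (intro vec3_eqI) simp_all
  moreover have "y \<in> slice_dom" using x(1) y12 by (auto simp: slice_dom_def chart_dom_def)
  ultimately show "p \<in> (chart l Q \<circ> slice s) ` slice_dom" using x(2) by (auto simp: image_iff)
qed

lemma chart_slice_has_derivative:
  "(chart l Q \<circ> slice s has_derivative
     frechet_derivative (chart l Q) (at (slice s y)) \<circ> frechet_derivative (slice s) (at y)) (at y)"
proof -
  have "(chart l Q has_derivative frechet_derivative (chart l Q) (at (slice s y))) (at (slice s y))"
    using chart_has_derivative[OF linear_Q]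
    by (auto simp: frechet_derivative_works[symmetric] differentiable_def)
  then show ?thesis
    using diff_chain_at[OF slice_has_derivative] by (simp add: frechet_slice)
qed

lemma pd_chart_slice: "pd a (chart l Q \<circ> slice s) y = pd (slice_index a) (chart l Q) (slice s y)"
  using pd_slice[of a s y]
  unfolding pd_def frechet_derivative_at[OF chart_slice_has_derivative, symmetric] o_apply by simp

lemma metric_coeff_chart_slice:
  "metric_coeff g (chart l Q \<circ> slice s) y $ a $ b
     = metric_coeff g (chart l Q) (slice s y) $ slice_index a $ slice_index b"
  by (simp add: metric_coeff_def pd_chart_slice)

text \<open>For constant \<open>s\<close> the chart is a trigonometric polynomial in latitude and longitude, so its smoothness
follows without a chain rule for \<open>Ck_on\<close>.\<close>

lemma chart_slice_smooth: "Ck_on k UNIV (chart l Q \<circ> slice s)"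
proof -
  have lin: "bounded_linear (\<lambda>y::real^2. y $ i)" for i by (rule bounded_linear_vec_nth)
  interpret linear Q by (rule linear_Q)
  have "chart l Q \<circ> slice s = (\<lambda>y. sin (pi * s / l) *\<^sub>R
      (cos (y$1) *\<^sub>R (cos (y$2) *\<^sub>R (Q (axis 1 1), 0) + sin (y$2) *\<^sub>R (Q (axis 2 1), 0))
        + sin (y$1) *\<^sub>R (Q (axis 3 1), 0)) + cos (pi * s / l) *\<^sub>R (0, 1))"
    by (rule ext) (simp add: chart_def polar_def geo_def add scaleR algebra_simps)
  then show ?thesis
    by (simp only:) (intro Ck_on_add Ck_on_scaleR Ck_on_sin_cos Ck_on_const lin)
qed

lemma continuous_chart_slice: "continuous_on S (chart l Q \<circ> slice s)"
  by (intro continuous_on_compose continuous_slice continuous_chart)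

lemma local_param_chart_slice:
  assumes s: "0 < s" "s < l"
  shows "local_param (chart l Q \<circ> slice s) slice_dom (latitude l s)"
  unfolding local_param_def
proof (intro conjI ballI)
  let ?\<phi> = "chart l Q \<circ> slice s"
  show "openin (top_of_set (latitude l s)) (?\<phi> ` slice_dom)"
    unfolding chart_slice_image[OF s] by (simp add: open_hemi openin_open_Int)
  show "inj (frechet_derivative ?\<phi> (at y))" if "y \<in> slice_dom" for y
  proof -
    have "inj (frechet_derivative (slice s) (at y))"
    proof (rule injI)
      fix u v assume "frechet_derivative (slice s) (at y) u = frechet_derivative (slice s) (at y) v"
      then have "(u$1 *\<^sub>R axis 2 1 + u$2 *\<^sub>R axis 3 1 :: real^3) $ i = (v$1 *\<^sub>R axis 2 1 + v$2 *\<^sub>R axis 3 1) $ i" for i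
        by (simp add: frechet_slice)
      from this[of 2] this[of 3] show "u = v" by (simp add: vec_eq_iff forall_2 axis_def)
    qed
    then show ?thesis
      unfolding frechet_derivative_at[OF chart_slice_has_derivative, symmetric]
      by (intro inj_compose inj_deriv_chart slice_in_chart_dom s that)
  qed
  show "\<exists>\<psi>. homeomorphism slice_dom (?\<phi> ` slice_dom) ?\<phi> \<psi>"
  proof -
    define \<psi> :: "pt \<Rightarrow> real^2" where
      "\<psi> p = (chart_inv l P p $ 2) *\<^sub>R axis 1 1 + (chart_inv l P p $ 3) *\<^sub>R axis 2 1" for p
    have inv: "\<psi> (?\<phi> y) = y" if "y \<in> slice_dom" for y
      using chart_in(2)[OF slice_in_chart_dom[OF s that]]
      by (simp add: \<psi>_def vec_eq_iff forall_2 axis_def del: chart_inv_nth)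
    have "?\<phi> ` slice_dom \<subseteq> S3 \<inter> hemi P"
      unfolding chart_slice_image[OF s] using latitude_closed(4) by auto
    then have "continuous_on (?\<phi> ` slice_dom) (chart_inv l P)"
      by (rule continuous_on_subset[OF continuous_chart_inv])
    then have "continuous_on (?\<phi> ` slice_dom) \<psi>"
      unfolding \<psi>_def by (intro continuous_intros)
    then show ?thesis
      by (intro exI[of _ \<psi>]) (use inv continuous_chart_slice in \<open>auto simp: homeomorphism_def image_image\<close>)
  qed
qed (use open_slice_dom chart_slice_smooth in \<open>auto intro: smooth_on_if_Ck\<close>)

end

text \<open>Conditions that quantify over the points of a sphere of latitude need to be checked only at the centre of
the coordinates, for a suitable frame.\<close>

lemma latitude_in_some_frame:
  assumes "p \<in> latitude l s"
  obtains Q P where "frame Q P" "p = chart l Q (slice s 0)"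
proof -
  obtain \<omega> where \<omega>: "norm \<omega> = 1" "p = polar l (s, \<omega>)" using assms by (auto simp: latitude_def)
  obtain Q P where "frame Q P" "Q (axis 1 1) = \<omega>" using frame_exists[OF \<omega>(1)] .
  moreover have "geo (slice s 0) = axis 1 1" by (intro vec3_eqI) (simp_all add: axis_def)
  ultimately show ?thesis using that \<omega>(2) by (simp add: chart_def)
qed

lemma zero_in_slice_dom: "0 \<in> slice_dom" by (simp add: slice_dom_def)

lemma closed_embedded_latitude:
  assumes s: "0 < s" "s < l"
  shows "closed_embedded_surface (latitude l s)"
  unfolding closed_embedded_surface_def
proof (intro conjI ballI)
  fix p assume "p \<in> latitude l s"
  then obtain Q P where "frame Q P" and p: "p = chart l Q (slice s 0)" by (rule latitude_in_some_frame)
  then interpret frame Q P by blast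
  have "p \<in> (chart l Q \<circ> slice s) ` slice_dom"
    using p zero_in_slice_dom by auto
  then show "\<exists>(\<phi>::real^2 \<Rightarrow> pt) U. local_param \<phi> U (latitude l s) \<and> p \<in> \<phi> ` U"
    using local_param_chart_slice[OF s] by blast
qed (use latitude_closed in auto)

context rot_sym begin

lemma rot_sym_frame: "frame Q' P' \<Longrightarrow> rot_sym Q' P' l f f' f'' g"
  using rs l_pos f_pos f_deriv f_deriv2 by (simp add: rot_sym_def rot_sym_axioms_def)

text \<open>The unit normal is the coordinate vector of \<open>s\<close>, and the second fundamental form has the components
\<open>\<Gamma>\<^sup>1\<^sub>i\<^sub>j\<close>, which are multiples of \<open>f f'\<close>. At a critical point of \<open>f\<close> each term of the trace vanishes, whatever
the inverse of the induced metric is.\<close>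

lemma mean_curvature_chart_slice:
  assumes s: "0 < s" "s < l" and crit: "f' s = 0"
  shows "has_mean_curvature g (latitude l s) (chart l Q (slice s 0)) 0"
  unfolding has_mean_curvature_def
proof (intro exI conjI)
  let ?\<nu> = "axis 1 1 :: real^3"
  have x: "slice s 0 \<in> chart_dom l" by (rule slice_in_chart_dom[OF s zero_in_slice_dom])
  have \<nu>: "G (slice s 0) *v ?\<nu> = ?\<nu>"
    by (simp add: matrix_vector_mult_def sum_3 vec_eq_iff forall_3 metric_coeff_chart[OF rs Q x] axis_def)
  show "local_param (chart l Q) (chart_dom l) S3" by (rule local_param_chart[OF l_pos])
  show "smooth_on slice_dom (slice s)" by (intro smooth_on_if_Ck slice_smooth)
  show "slice s ` slice_dom \<subseteq> chart_dom l" using slice_in_chart_dom[OF s] by auto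
  show "local_param (chart l Q \<circ> slice s) slice_dom (latitude l s)" by (rule local_param_chart_slice[OF s])
  show "0 \<in> slice_dom" by (rule zero_in_slice_dom)
  show "chart l Q (slice s 0) = chart l Q (slice s 0)" ..
  show "?\<nu> \<bullet> (G (slice s 0) *v ?\<nu>) = 1" by (simp add: \<nu> inner_axis)
  have idx: "axis (slice_index a) 1 $ 1 = (0::real)" for a by (simp add: slice_index_def axis_def)
  show "\<forall>a. pd a (slice s) 0 \<bullet> (G (slice s 0) *v ?\<nu>) = 0"
    by (simp add: \<nu> pd_slice inner_axis idx)
  have "christoffel G 1 i j (slice s 0) = 0" for i j
    by (simp add: christoffel_G[OF x] chr_s_def crit)
  then have "cov_pd G (slice s) a b 0 \<bullet> (G (slice s 0) *v ?\<nu>) = 0" for a b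
    by (simp add: \<nu> inner_axis cov_pd_def pd_slice idx) (simp add: pd_def)
  then show "0 = (\<Sum>a\<in>UNIV. \<Sum>b\<in>UNIV. matrix_inv (metric_coeff g (chart l Q \<circ> slice s) 0) $ a $ b *
      (cov_pd G (slice s) a b 0 \<bullet> (G (slice s 0) *v ?\<nu>)))"
    by simp
qed

lemma minimal_latitude:
  assumes s: "0 < s" "s < l" and crit: "f' s = 0"
  shows "minimal_surface g (latitude l s)"
  unfolding minimal_surface_def
proof
  fix p assume "p \<in> latitude l s"
  then obtain Q' P' where F: "frame Q' P'" and p: "p = chart l Q' (slice s 0)"
    by (rule latitude_in_some_frame)
  interpret F: rot_sym Q' P' l f f' f'' g by (rule rot_sym_frame[OF F])
  show "has_mean_curvature g (latitude l s) p 0"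
    unfolding p by (rule F.mean_curvature_chart_slice[OF s crit])
qed

text \<open>The area density is \<open>f(s)\<^sup>2 cos \<theta>\<close>.\<close>

lemma area_density_chart_slice:
  assumes s: "0 < s" "s < l" and y: "y \<in> slice_dom"
  shows "sqrt (det (metric_coeff g (chart l Q \<circ> slice s) y)) \<le> (f s)\<^sup>2"
proof -
  have "det (metric_coeff g (chart l Q \<circ> slice s) y) = ((f s)\<^sup>2 * cos (y$1))\<^sup>2"
    by (simp add: det_2 metric_coeff_chart_slice metric_coeff_chart[OF rs Q slice_in_chart_dom[OF s y]]
        slice_index_def power2_eq_square)
  then show ?thesis by (simp add: abs_mult mult_left_le)
qed

end

lemma latitude_hemi_cover:
  assumes p: "p \<in> latitude l s" and s: "0 < s" "s < l"
  obtains k \<epsilon> where "\<epsilon> \<in> {1, -1}" "0 < fst p \<bullet> (\<epsilon> *\<^sub>R axis k 1)"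
proof -
  obtain \<omega> :: "real^3" where \<omega>: "norm \<omega> = 1" "p = polar l (s, \<omega>)" using p by (auto simp: latitude_def)
  then have "fst p \<noteq> 0" using sin_chart_pos[OF s] by (auto simp: polar_def)
  then obtain k where "fst p $ k \<noteq> 0" by (auto simp: vec_eq_iff)
  then show ?thesis using that[of 1 k] that[of "-1" k] by (cases "fst p $ k > 0") (auto simp: inner_axis)
qed

context rot_sym begin

text \<open>Six open hemispheres, centred at the points where the coordinate axes meet the 2-sphere, cover it. Removing
from each the previous ones gives disjoint Borel pieces, and each piece has at most the area of the coordinate
square times \<open>f(s)\<^sup>2\<close>. The exact value \<open>4 pi f(s)\<^sup>2\<close> does not matter: a bound that tends to \<open>0\<close>
with \<open>f(s)\<close> suffices.\<close>

lemma area_latitude: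
  assumes s: "0 < s" "s < l"
  obtains a where "has_area g (latitude l s) a" "a \<le> ennreal (6 * measure lborel slice_dom * (f s)\<^sup>2)"
proof -
  define u :: "nat \<Rightarrow> real^3" where
    "u i = [axis 1 1, - axis 1 1, axis 2 1, - axis 2 1, axis 3 1, - axis 3 1] ! i" for i
  have "\<exists>QP. frame (fst QP) (snd QP) \<and> fst QP (axis 1 1) = u i" if "i < 6" for i
  proof -
    have "norm (u i) = 1" using that unfolding u_def
      by (auto simp: less_Suc_eq numeral_eq_Suc nth_Cons split: nat.splits)
    from frame_exists[OF this] show ?thesis by (metis fst_conv snd_conv)
  qed
  then obtain QP where QP: "\<And>i. i < 6 \<Longrightarrow> frame (fst (QP i)) (snd (QP i)) \<and> fst (QP i) (axis 1 1) = u i"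
    by metis
  define \<phi> where "\<phi> i = chart l (fst (QP i)) \<circ> slice s" for i
  define H where "H i = {p :: pt. 0 < fst p \<bullet> u i}" for i
  \<comment> \<open>The hemisphere number \<open>i\<close>, in coordinates, without the previous hemispheres.\<close>
  define B where "B i = slice_dom \<inter> (\<Inter>k<i. \<phi> i -` (- H k))" for i
  have im: "\<phi> i ` slice_dom = latitude l s \<inter> H i" if "i < 6" for i
    using frame.chart_slice_image[of "fst (QP i)" "snd (QP i)" s l] frame.hemi_eq[of "fst (QP i)" "snd (QP i)"]
      QP[OF that] s
    by (simp add: \<phi>_def H_def)
  have "open (H i)" for i unfolding H_def by (intro open_Collect_less continuous_intros)
  moreover have "continuous_on UNIV (\<phi> i)" if "i < 6" for i
    using frame.continuous_chart_slice QP[OF that] unfolding \<phi>_def by blast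
  ultimately have "closed (\<phi> i -` (- H k))" if "i < 6" for i k
    using that by (intro closed_vimage) auto
  then have B: "B i \<in> sets borel" if "i < 6" for i
    using that open_slice_dom unfolding B_def by (intro sets.Int borel_open borel_closed closed_INT) auto
  have cover: "(\<Union>i<6. \<phi> i ` B i) = latitude l s"
  proof (intro equalityI subsetI)
    fix p assume "p \<in> (\<Union>i<6. \<phi> i ` B i)"
    then show "p \<in> latitude l s" using im unfolding B_def by blast
  next
    fix p assume p: "p \<in> latitude l s"
    obtain k :: 3 and \<epsilon> :: real where k: "\<epsilon> \<in> {1, -1}" "0 < fst p \<bullet> (\<epsilon> *\<^sub>R axis k 1)"
      by (rule latitude_hemi_cover[OF p s])
    have "\<exists>i<6. u i = \<epsilon> *\<^sub>R axis k 1"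
    proof -
      have "\<epsilon> *\<^sub>R axis k 1 \<in> u ` {0,1,2,3,4,5}"
        using k(1) exhaust_3[of k] by (auto simp: u_def)
      then obtain i where "i \<in> {0,1,2,3,4,5}" "u i = \<epsilon> *\<^sub>R axis k 1"
        by (metis imageE)
      then show ?thesis by (intro exI[of _ i]) auto
    qed
    then have ex: "\<exists>i. i < 6 \<and> p \<in> H i" using k(2) by (auto simp: H_def)
    define i where "i = (LEAST i. i < 6 \<and> p \<in> H i)"
    have i: "i < 6" "p \<in> H i" using LeastI_ex[OF ex] by (simp_all add: i_def)
    have "p \<notin> H k" if "k < i" for k
      using not_less_Least[of k "\<lambda>i. i < 6 \<and> p \<in> H i"] that i(1) by (auto simp: i_def)
    moreover obtain y where "y \<in> slice_dom" "p = \<phi> i y" using im[OF i(1)] i(2) p by blast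
    ultimately show "p \<in> (\<Union>i<6. \<phi> i ` B i)" using i(1) by (auto simp: B_def)
  qed
  have "\<phi> i ` B i \<inter> \<phi> k ` B k = {}" if "i < k" "k < 6" for i k
    using im[of i] that unfolding B_def by fastforce
  then have disj: "disjoint_family_on (\<lambda>i. \<phi> i ` B i) {..<6}"
    unfolding disjoint_family_on_def by (metis Int_commute lessThan_iff linorder_neqE_nat)
  let ?a = "\<Sum>i<6. \<integral>\<^sup>+y\<in>B i. ennreal (sqrt (det (metric_coeff g (\<phi> i) y))) \<partial>lborel"
  have "has_area g (latitude l s) ?a"
    unfolding has_area_def
  proof (intro exI conjI)
    show "\<forall>i<6. local_param (\<phi> i) slice_dom (latitude l s) \<and> B i \<in> sets borel \<and> B i \<subseteq> slice_dom"
      using B frame.local_param_chart_slice[OF _ s] QP unfolding \<phi>_def by (auto simp: B_def)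
  qed (rule disj cover refl)+
  moreover have "?a \<le> ennreal (6 * measure lborel slice_dom * (f s)\<^sup>2)"
  proof -
    have "(\<integral>\<^sup>+y\<in>B i. ennreal (sqrt (det (metric_coeff g (\<phi> i) y))) \<partial>lborel)
        \<le> ennreal (measure lborel slice_dom * (f s)\<^sup>2)" if "i < 6" for i
    proof -
      interpret F: rot_sym "fst (QP i)" "snd (QP i)" l f f' f'' g
        using QP[OF that] by (intro rot_sym_frame) auto
      have "(\<integral>\<^sup>+y\<in>B i. ennreal (sqrt (det (metric_coeff g (\<phi> i) y))) \<partial>lborel)
          \<le> (\<integral>\<^sup>+y. ennreal ((f s)\<^sup>2) * indicator slice_dom y \<partial>lborel)"
        unfolding \<phi>_def using F.area_density_chart_slice[OF s]
        by (intro nn_integral_mono) (auto simp: indicator_def B_def intro: ennreal_leI)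
      also have "\<dots> = ennreal ((f s)\<^sup>2) * emeasure lborel slice_dom"
        using open_slice_dom by (intro nn_integral_cmult_indicator) auto
      also have "emeasure lborel slice_dom = ennreal (measure lborel slice_dom)"
        using emeasure_bounded_finite[OF bounded_slice_dom] by (intro emeasure_eq_ennreal_measure) auto
      finally show ?thesis by (simp add: ennreal_mult mult.commute)
    qed
    then have "?a \<le> (\<Sum>i<(6::nat). ennreal (measure lborel slice_dom * (f s)\<^sup>2))"
      by (intro sum_mono) auto
    also have "\<dots> = ennreal (\<Sum>i<(6::nat). measure lborel slice_dom * (f s)\<^sup>2)"
      by (intro sum_ennreal) auto
    finally show ?thesis by (simp add: mult.assoc)
  qed
  ultimately show ?thesis using that by blast
qed

lemma MinA_le:
  assumes s: "0 < s" "s < l" and crit: "f' s = 0"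
  shows "MinA g \<le> ennreal (6 * measure lborel slice_dom * (f s)\<^sup>2)"
proof -
  obtain a where a: "has_area g (latitude l s) a" "a \<le> ennreal (6 * measure lborel slice_dom * (f s)\<^sup>2)"
    by (rule area_latitude[OF s])
  have "MinA g \<le> a"
    unfolding MinA_def using a(1) closed_embedded_latitude[OF s] minimal_latitude[OF s crit]
    by (intro Inf_lower) blast
  then show ?thesis using a(2) by (rule order.trans)
qed

end

section \<open>The distance between the poles\<close>

text \<open>Split \<open>v\<close> into its radial part \<open>a\<close> and a part tangent to the sphere of latitude. The pullback formula
gives \<open>g p v v = a\<^sup>2 + f\<^sup>2 \<bar>w\<bar>\<^sup>2 \<ge> a\<^sup>2\<close>, and \<open>a\<close> is the derivative of the distance from the pole,
\<open>l / pi * arccos (snd p)\<close>, in the direction \<open>v\<close>.\<close>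

lemma metric_ge_radial:
  assumes rs: "rot_sym_metric l f g" and l: "l > 0" and p: "norm p = 1" "\<bar>snd p\<bar> < 1" and v: "v \<bullet> p = 0"
  shows "(l / pi * snd v / sqrt (1 - (snd p)\<^sup>2))\<^sup>2 \<le> g p v v"
proof -
  define c where "c = snd p"
  define r where "r = sqrt (1 - c\<^sup>2)"
  define s where "s = l / pi * arccos c"
  define \<omega> where "\<omega> = (1 / r) *\<^sub>R fst p"
  define a where "a = - (l / pi * snd v / r)"
  define w where "w = (1 / r) *\<^sub>R (fst v - (c * (pi / l) * a) *\<^sub>R \<omega>)"
  have c: "-1 < c" "c < 1" using p by (auto simp: c_def)
  then have "c\<^sup>2 < 1" using p by (simp add: abs_square_less_1 c_def)
  then have r: "r > 0" "r\<^sup>2 = 1 - c\<^sup>2" by (auto simp: r_def)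
  have ac: "0 < arccos c" "arccos c < pi" using c arccos_lt_bounded by auto
  have s: "s \<in> {0<..<l}" using ac l by (simp add: s_def field_simps)
  have ps: "pi * s / l = arccos c" using l by (simp add: s_def)
  have cos_s: "cos (pi * s / l) = c" and sin_s: "sin (pi * s / l) = r"
    unfolding ps using c by (simp_all add: sin_arccos r_def)
  have "(norm (fst p))\<^sup>2 + c\<^sup>2 = 1"
    using p(1) norm_Pair[of "fst p" "snd p"] by (simp add: c_def)
  then have np: "norm (fst p) = r" using r by (metis add_diff_cancel_right' norm_ge_zero power2_eq_imp_eq less_imp_le)
  then have \<omega>: "\<omega> \<in> sphere 0 1" using r by (simp add: \<omega>_def)
  have r\<omega>: "r *\<^sub>R \<omega> = fst p" using r by (simp add: \<omega>_def)
  have "fst v \<bullet> fst p + snd v * c = 0"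
    using v by (simp add: c_def inner_prod_def)
  then have "r * (fst v \<bullet> \<omega>) = - (snd v * c)" by (simp flip: r\<omega>)
  then have fv: "fst v \<bullet> \<omega> = - (snd v * c) / r" using r by (simp add: field_simps)
  have "w \<bullet> \<omega> = (1 / r) * (fst v \<bullet> \<omega> - c * (pi / l) * a)"
    using \<omega> by (simp add: w_def inner_diff_left dot_square_norm)
  also have "\<dots> = 0" using l r by (simp add: fv a_def)
  finally have w: "w \<bullet> \<omega> = 0" .
  have "polar l (s, \<omega>) = p"
    by (simp add: polar_def prod_eq_iff cos_s sin_s r\<omega>) (simp add: c_def)
  moreover have "polar' l s \<omega> (a, w) = v"
    using r l by (simp add: polar'_def prod_eq_iff cos_s sin_s w_def a_def)
  moreover have "g (polar l (s, \<omega>)) (polar' l s \<omega> (a, w)) (polar' l s \<omega> (a, w)) = a * a + (f s)\<^sup>2 * (w \<bullet> w)"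
    using rs s \<omega> w unfolding rot_sym_metric_def frechet_polar by blast
  ultimately have "g p v v = a * a + (f s)\<^sup>2 * (w \<bullet> w)" by simp
  moreover have "0 \<le> (f s)\<^sup>2 * (w \<bullet> w)" by simp
  ultimately have "a\<^sup>2 \<le> g p v v" by (simp add: power2_eq_square)
  then show ?thesis by (simp add: a_def r_def c_def)
qed

text \<open>Along the path the function \<open>u = l / pi * arccos (snd p)\<close> goes from \<open>0\<close> to \<open>l\<close>, and
its derivative is at most the speed of the path (\<open>metric_ge_radial\<close>). At the poles \<open>u\<close> need
not be differentiable, so the path is cut down to a part that meets the poles only at its ends.\<close>

lemma curve_length_ge:
  assumes rs: "rot_sym_metric l f g" and l: "l > 0"
    and \<gamma>: "valid_path \<gamma>" "path_image \<gamma> \<subseteq> S3" "pathstart \<gamma> = (0, 1)" "pathfinish \<gamma> = (0, -1)"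
  shows "ennreal l \<le> curve_length g \<gamma>"
proof -
  define z where "z t = snd (\<gamma> t)" for t
  define d where "d t = vector_derivative \<gamma> (at t)" for t
  define u where "u t = l / pi * arccos (z t)" for t
  define u' where "u' t = - (l / pi * snd (d t) / sqrt (1 - (z t)\<^sup>2))" for t
  obtain E where E: "finite E" "\<gamma> C1_differentiable_on ({0..1} - E)" and cont: "continuous_on {0..1} \<gamma>"
    using \<gamma>(1) unfolding valid_path_def piecewise_C1_differentiable_on_def by blast
  have S: "norm (\<gamma> t) = 1" if "t \<in> {0..1}" for t
    using \<gamma>(2) that by (auto simp: path_image_def S3_def image_subset_iff)
  have z1: "\<bar>z t\<bar> \<le> 1" if "t \<in> {0..1}" for t
    using norm_snd_le[of "snd (\<gamma> t)" "fst (\<gamma> t)"] S[OF that] by (simp add: z_def)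
  have zc: "continuous_on {0..1} z" unfolding z_def by (intro continuous_intros cont)
  have z01: "z 0 = 1" "z 1 = -1" using \<gamma>(3,4) by (auto simp: z_def pathstart_def pathfinish_def)
  have cl: "compact {t \<in> {a..b}. z t = y}" if "0 \<le> a" "b \<le> 1" for a b y
  proof -
    have "closed {t \<in> {a..b}. z t = y}"
      using that by (intro continuous_closed_preimage_constant continuous_on_subset[OF zc]) auto
    then show ?thesis by (metis (no_types, lifting) bounded_closed_interval bounded_subset compact_eq_bounded_closed mem_Collect_eq subsetI)
  qed
  \<comment> \<open>\<open>T\<close> is the first time at the second pole, \<open>t0\<close> the last time before it at the first pole.\<close>
  obtain T where T: "T \<in> {0..1}" "z T = -1" "\<And>t. t \<in> {0..1} \<Longrightarrow> z t = -1 \<Longrightarrow> T \<le> t"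
  proof -
    have "1 \<in> {t \<in> {0..1}. z t = -1}" using z01 by simp
    then have "\<exists>T\<in>{t \<in> {0..1}. z t = -1}. \<forall>t\<in>{t \<in> {0..1}. z t = -1}. T \<le> t"
      by (intro compact_attains_inf cl) auto
    then show ?thesis using that by blast
  qed
  obtain t0 where t0: "t0 \<in> {0..T}" "z t0 = 1" "\<And>t. t \<in> {0..T} \<Longrightarrow> z t = 1 \<Longrightarrow> t \<le> t0"
  proof -
    have "0 \<in> {t \<in> {0..T}. z t = 1}" using z01 T(1) by simp
    then have "\<exists>s\<in>{t \<in> {0..T}. z t = 1}. \<forall>t\<in>{t \<in> {0..T}. z t = 1}. t \<le> s"
      using T(1) by (intro compact_attains_sup cl) auto
    then show ?thesis using that by blast
  qed
  have lt: "t0 \<le> T" using t0 by auto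
  have sub: "{t0..T} \<subseteq> {0..1}" using T t0 by auto
  have zlt: "\<bar>z t\<bar> < 1" if "t \<in> {t0<..<T}" for t
  proof -
    have "t \<in> {0..1}" using that sub by auto
    moreover have "z t \<noteq> -1" using T(3)[of t] that calculation by auto
    moreover have "z t \<noteq> 1" using t0(3)[of t] that t0(1) by auto
    ultimately show ?thesis using z1[of t] by linarith
  qed
  have "\<gamma> differentiable at t" if "t \<in> {0..1} - E" for t
    using E(2) that by (auto simp: C1_differentiable_on_eq)
  then have d: "(\<gamma> has_vector_derivative d t) (at t)" if "t \<in> {0..1} - E" for t
    using that by (simp add: d_def vector_derivative_works)
  have perp: "d t \<bullet> \<gamma> t = 0" if t: "t \<in> {t0<..<T} - E" for t
  proof -
    have dt: "(\<gamma> has_vector_derivative d t) (at t)" using t sub by (intro d) auto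
    have "((\<lambda>t. \<gamma> t \<bullet> \<gamma> t) has_derivative (\<lambda>h. \<gamma> t \<bullet> (h *\<^sub>R d t) + (h *\<^sub>R d t) \<bullet> \<gamma> t)) (at t)"
      using dt unfolding has_vector_derivative_def by (intro has_derivative_inner)
    moreover have "((\<lambda>t. \<gamma> t \<bullet> \<gamma> t) has_derivative (\<lambda>h. 0)) (at t)"
    proof (rule has_derivative_transform_within_open)
      show "((\<lambda>t::real. 1::real) has_derivative (\<lambda>h. 0)) (at t)" by simp
      show "open {t0<..<T}" "t \<in> {t0<..<T}" using t by auto
      show "1 = \<gamma> x \<bullet> \<gamma> x" if "x \<in> {t0<..<T}" for x
        using S[of x] that sub by (auto simp: dot_square_norm)
    qed
    ultimately have "(\<lambda>h. \<gamma> t \<bullet> (h *\<^sub>R d t) + (h *\<^sub>R d t) \<bullet> \<gamma> t) = (\<lambda>h. 0)"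
      by (rule has_derivative_unique)
    from fun_cong[OF this, of 1] show ?thesis by (simp add: inner_commute)
  qed
  have du: "(u has_vector_derivative u' t) (at t)" if t: "t \<in> {t0<..<T} - E" for t
  proof -
    have "(\<gamma> has_vector_derivative d t) (at t)" using t sub by (intro d) auto
    then have "(z has_vector_derivative snd (d t)) (at t)"
      unfolding z_def by (rule bounded_linear.has_vector_derivative[OF bounded_linear_snd])
    then have "(z has_real_derivative snd (d t)) (at t)"
      by (simp add: has_real_derivative_iff_has_vector_derivative)
    then have "(u has_real_derivative u' t) (at t)"
      unfolding u_def u'_def using zlt[of t] t
      by (auto intro!: derivative_eq_intros simp: abs_less_iff divide_inverse)
    then show ?thesis by (simp add: has_real_derivative_iff_has_vector_derivative)
  qed
  have "continuous_on {t0..T} u"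
    unfolding u_def using sub z1
    by (intro continuous_intros continuous_on_subset[OF zc]) (auto simp: abs_le_iff minus_le_iff)
  then have "(u' has_integral (u T - u t0)) {t0..T}"
    using du by (intro fundamental_theorem_of_calculus_interior_strong[OF E(1) lt]) auto
  moreover have "u T - u t0 = l" using T(2) t0(2) by (simp add: u_def)
  ultimately have I: "(u' has_integral l) {t0..T}" by simp
  let ?w = "\<lambda>t. u' t * indicator {t0..T} t"
  have m: "?w \<in> borel_measurable lebesgue"
    by (rule has_integral_implies_lebesgue_measurable_real[OF I])
  have "E \<union> {t0, T} \<in> null_sets lborel"
    using E(1) by (intro finite_imp_null_set_lborel) auto
  then have ae: "AE t in lborel. t \<notin> E \<union> {t0, T}" by (rule AE_not_in)
  have "(\<integral>\<^sup>+t. ennreal \<bar>?w t\<bar> \<partial>lebesgue) = (\<integral>\<^sup>+t. ennreal \<bar>?w t\<bar> \<partial>lborel)"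
    by (rule nn_integral_completion)
  also have "\<dots> \<le> curve_length g \<gamma>"
    unfolding curve_length_def
  proof (rule nn_integral_mono_AE)
    show "AE t in lborel. ennreal \<bar>?w t\<bar> \<le> ennreal (sqrt (g (\<gamma> t) (vector_derivative \<gamma> (at t)) (vector_derivative \<gamma> (at t)))) * indicator {0..1} t"
      using ae
    proof eventually_elim
      case (elim t)
      show ?case
      proof (cases "t \<in> {t0<..<T}")
        case True
        then have t01: "t \<in> {0..1}" using sub by auto
        have "(l / pi * snd (d t) / sqrt (1 - (snd (\<gamma> t))\<^sup>2))\<^sup>2 \<le> g (\<gamma> t) (d t) (d t)"
          using True elim zlt[of t] by (intro metric_ge_radial[OF rs l S[OF t01]] perp) (auto simp: z_def)
        then have "(u' t)\<^sup>2 \<le> g (\<gamma> t) (d t) (d t)"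
          unfolding u'_def z_def by simp
        then have "\<bar>u' t\<bar> \<le> sqrt (g (\<gamma> t) (d t) (d t))"
          by (rule real_le_rsqrt[of "\<bar>u' t\<bar>", simplified])
        then show ?thesis using True t01 by (simp add: d_def indicator_def ennreal_leI)
      next
        case False
        with elim have "t \<notin> {t0..T}" by auto
        then have w0: "ennreal \<bar>?w t\<bar> = 0" by simp
        show ?thesis unfolding w0 by (rule zero_le)
      qed
    qed
  qed
  finally have le: "(\<integral>\<^sup>+t. ennreal \<bar>?w t\<bar> \<partial>lebesgue) \<le> curve_length g \<gamma>" .
  show ?thesis
  proof (cases "(\<integral>\<^sup>+t. ennreal \<bar>?w t\<bar> \<partial>lebesgue) < \<infinity>")
    case True
    then have int: "integrable lebesgue ?w"
      using m by (intro integrableI_bounded) auto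
    then have si: "set_integrable lebesgue {t0..T} u'"
      by (simp add: set_integrable_def mult.commute)
    have "(LINT t:{t0..T}|lebesgue. u' t) = l"
      using set_lebesgue_integral_eq_integral(2)[OF si] integral_unique[OF I] by simp
    then have "l = (LINT t|lebesgue. ?w t)"
      by (simp add: set_lebesgue_integral_def mult.commute)
    also have "\<dots> \<le> (LINT t|lebesgue. \<bar>?w t\<bar>)"
      using int by (intro integral_mono integrable_abs) auto
    finally have "ennreal l \<le> ennreal (LINT t|lebesgue. \<bar>?w t\<bar>)" by (rule ennreal_leI)
    also have "\<dots> = (\<integral>\<^sup>+t. ennreal \<bar>?w t\<bar> \<partial>lebesgue)"
      using int by (intro nn_integral_eq_integral[symmetric] integrable_abs) auto
    also note le
    finally show ?thesis .
  next
    case False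
    then have top: "(\<integral>\<^sup>+t. ennreal \<bar>?w t\<bar> \<partial>lebesgue) = top"
      by (metis infinity_ennreal_def less_top)
    have "curve_length g \<gamma> = top" using le unfolding top by (rule top_le)
    then show ?thesis by simp
  qed
qed

lemma Diam_ge:
  assumes "rot_sym_metric l f g" "l > 0"
  shows "ennreal l \<le> Diam g"
proof -
  have "ennreal l \<le> riem_dist g (0, 1) (0, -1)"
    unfolding riem_dist_def using curve_length_ge[OF assms] by (intro Inf_greatest) blast
  also have "(0, 1) \<in> S3" "(0, -1) \<in> S3" by (auto simp: S3_def norm_prod_def)
  then have "riem_dist g (0, 1) (0, -1) \<le> Diam g"
    unfolding Diam_def by (meson SUP_upper2 SUP_upper)
  finally show ?thesis .
qed

section \<open>Convergence of the derivatives of concave functions\<close>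

text \<open>A concave function satisfies \<open>slope over [x, y] \<le> k' x \<le> slope over [a, x]\<close> for \<open>a < x < y\<close>, and slopes
converge with the functions. So every limit point of \<open>k' n x\<close> is at most \<open>S x\<close>, the infimum of the limiting
slopes to the left of \<open>x\<close>, and at least every limiting slope over \<open>[x, y]\<close>, which is at least \<open>S y\<close>.
As \<open>S\<close> is decreasing, it has at most countably many discontinuities; at its points of continuity the
two bounds agree.\<close>

lemma concave_derivatives_converge:
  fixes k k' :: "nat \<Rightarrow> real \<Rightarrow> real"
  assumes deriv: "\<And>n x. x \<in> {c<..<d} \<Longrightarrow> (k n has_real_derivative k' n x) (at x)"
    and anti: "\<And>n x y. x \<in> {c<..<d} \<Longrightarrow> y \<in> {c<..<d} \<Longrightarrow> x \<le> y \<Longrightarrow> k' n y \<le> k' n x"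
    and lim: "\<And>x. x \<in> {c<..<d} \<Longrightarrow> (\<lambda>n. k n x) \<longlonglongrightarrow> K x"
  shows "\<exists>E. countable E \<and> (\<forall>x\<in>{c<..<d} - E. convergent (\<lambda>n. k' n x))"
proof -
  define q where "q n x y = (k n y - k n x) / (y - x)" for n x y
  define Q where "Q x y = (K y - K x) / (y - x)" for x y
  define S where "S x = Inf ((\<lambda>a. Q a x) ` {c<..<x})" for x
  have q: "k' n y \<le> q n x y \<and> q n x y \<le> k' n x" if "x \<in> {c<..<d}" "y \<in> {c<..<d}" "x < y" for n x y
  proof -
    have "\<exists>z. x < z \<and> z < y \<and> k n y - k n x = (y - x) * k' n z"
      using that by (intro MVT2) (auto intro: deriv)
    then obtain z where z: "x < z" "z < y" "k n y - k n x = (y - x) * k' n z" by blast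
    then have "q n x y = k' n z" using that by (simp add: q_def)
    with z that anti[of z y n] anti[of x z n] show ?thesis by auto
  qed
  have qlim: "(\<lambda>n. q n x y) \<longlonglongrightarrow> Q x y" if "x \<in> {c<..<d}" "y \<in> {c<..<d}" "x < y" for x y
    unfolding q_def Q_def using that by (intro tendsto_intros lim) auto
  have Q: "Q x b \<le> Q a x" if "a \<in> {c<..<d}" "b \<in> {c<..<d}" "a < x" "x < b" for a x b
  proof (rule LIMSEQ_le)
    show "(\<lambda>n. q n x b) \<longlonglongrightarrow> Q x b" "(\<lambda>n. q n a x) \<longlonglongrightarrow> Q a x"
      using that by (auto intro: qlim)
    show "\<exists>N. \<forall>n\<ge>N. q n x b \<le> q n a x"
      using q[of x b] q[of a x] that by (meson greaterThanLessThan_iff less_trans order_trans)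
  qed
  have S_ge: "Q x b \<le> S x" if "x \<in> {c<..<d}" "b \<in> {c<..<d}" "x < b" for x b
    unfolding S_def using that Q[of _ b x] dense[of c x] by (intro cInf_greatest) auto
  have bdd: "bdd_below ((\<lambda>a. Q a x) ` {c<..<x})" if x: "x \<in> {c<..<d}" for x
  proof -
    obtain b where "x < b" "b < d" using x dense by auto
    then have "\<And>a. a \<in> {c<..<x} \<Longrightarrow> Q x b \<le> Q a x" using x Q by auto
    then show ?thesis by (rule bdd_belowI2)
  qed
  have S_le: "S x \<le> Q a x" if "x \<in> {c<..<d}" "a \<in> {c<..<d}" "a < x" for x a
    unfolding S_def using that by (intro cInf_lower bdd) auto
  have "mono_on {c<..<d} (\<lambda>x. - S x)"
  proof (rule mono_onI)
    fix x y assume "x \<in> {c<..<d}" "y \<in> {c<..<d}" "x \<le> y"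
    then show "- S x \<le> - S y"
      using S_le[of y x] S_ge[of x y] by (cases "x = y") auto
  qed
  then have E: "countable {x\<in>{c<..<d}. \<not> isCont (\<lambda>x. - S x) x}"
    by (intro mono_on_ctble_discont_open) auto
  have "convergent (\<lambda>n. k' n x)" if x: "x \<in> {c<..<d}" and cont: "isCont (\<lambda>x. - S x) x" for x
  proof (rule convergentI, rule order_tendstoI)
    fix e assume "S x < e"
    moreover have "(\<lambda>a. Q a x) ` {c<..<x} \<noteq> {}" using x by auto
    ultimately obtain a where a: "a \<in> {c<..<x}" "Q a x < e"
      unfolding S_def by (subst (asm) cInf_less_iff) (use bdd[OF x] in auto)
    then have "\<forall>\<^sub>F n in sequentially. q n a x < e"
      using x qlim[of a x] by (intro order_tendstoD) auto
    moreover have le: "k' n x \<le> q n a x" for n using q[of a x n] a x by auto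
    ultimately show "\<forall>\<^sub>F n in sequentially. k' n x < e"
      by (auto elim!: eventually_mono intro: le_less_trans[OF le])
  next
    fix e assume e: "e < S x"
    have "isCont S x" using isCont_minus[OF cont] by simp
    then have "\<forall>\<^sub>F y in at x. e < S y"
      using e by (auto simp: isCont_def intro: order_tendstoD)
    then have "\<forall>\<^sub>F y in at_right x. e < S y"
      by (simp add: eventually_at_split)
    moreover have "\<forall>\<^sub>F y in at_right x. y \<in> {x<..<d}"
      using x by (intro eventually_at_right_real) auto
    ultimately have "\<forall>\<^sub>F y in at_right x. e < S y \<and> y \<in> {x<..<d}"
      by eventually_elim auto
    then obtain y where y: "e < S y" "y \<in> {x<..<d}"
      using eventually_happens'[OF trivial_limit_at_right_real] by blast
    then have "e < Q x y" using x S_le[of y x] by auto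
    then have "\<forall>\<^sub>F n in sequentially. e < q n x y"
      using x y qlim[of x y] by (intro order_tendstoD) auto
    moreover have le: "q n x y \<le> k' n x" for n using q[of x y n] y x by auto
    ultimately show "\<forall>\<^sub>F n in sequentially. e < k' n x"
      by (auto elim!: eventually_mono intro: less_le_trans[OF _ le])
  qed
  then show ?thesis using E by (intro exI[of _ "{x\<in>{c<..<d}. \<not> isCont (\<lambda>x. - S x) x}"]) auto
qed

section \<open>Sobolev functions\<close>

lemma bounded_convergence_on:
  fixes w :: "nat \<Rightarrow> real \<Rightarrow> real" and z :: "real \<Rightarrow> real"
  assumes J: "open J" "bounded J" and E: "countable E"
    and meas: "\<And>n. set_borel_measurable lebesgue J (w n)" "set_borel_measurable lebesgue J z"
    and bound: "\<And>n x. x \<in> J \<Longrightarrow> \<bar>w n x\<bar> \<le> B"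
    and lim: "\<And>x. x \<in> J - E \<Longrightarrow> (\<lambda>n. w n x) \<longlonglongrightarrow> z x"
  shows "(\<lambda>n. LINT x:J|lebesgue. w n x) \<longlonglongrightarrow> (LINT x:J|lebesgue. z x)"
  unfolding set_lebesgue_integral_def
proof (rule integral_dominated_convergence[where w = "\<lambda>x. B * indicator J x"])
  have "J \<in> lmeasurable" using J by (simp add: lmeasurable_open)
  then show "integrable lebesgue (\<lambda>x. B * indicator J x)"
    by (auto simp: fmeasurable_def intro!: integrable_mult_right integrable_real_indicator)
  have "E \<in> null_sets lebesgue"
    using countable_imp_null_set_lborel[OF E] by (rule null_sets_completionI)
  then have "AE x in lebesgue. x \<notin> E" by (rule AE_not_in)
  then show "AE x in lebesgue. (\<lambda>n. indicat_real J x *\<^sub>R w n x) \<longlonglongrightarrow> indicat_real J x *\<^sub>R z x"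
  proof eventually_elim
    case (elim x)
    show ?case
      by (cases "x \<in> J") (use lim[of x] elim in \<open>auto simp: indicator_def\<close>)
  qed
  show "AE x in lebesgue. norm (indicat_real J x *\<^sub>R w n x) \<le> B * indicator J x" for n
    using bound[of _ n] by (intro AE_I2) (auto simp: indicator_def)
qed (use meas in \<open>auto simp: set_borel_measurable_def\<close>)

lemma set_integrable_bounded:
  fixes w :: "real \<Rightarrow> real"
  assumes J: "open J" "bounded J" and meas: "set_borel_measurable lebesgue J w"
    and bound: "\<And>x. x \<in> J \<Longrightarrow> \<bar>w x\<bar> \<le> B"
  shows "set_integrable lebesgue J w"
  unfolding set_integrable_def
proof (rule Bochner_Integration.integrable_bound)
  have "J \<in> lmeasurable" using J by (simp add: lmeasurable_open)
  then show "integrable lebesgue (\<lambda>x. B * indicator J x)"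
    by (auto simp: fmeasurable_def intro!: integrable_mult_right integrable_real_indicator)
  show "AE x in lebesgue. norm (indicat_real J x *\<^sub>R w x) \<le> norm (B * indicator J x)"
    using bound by (intro AE_I2) (force simp: indicator_def)
qed (use meas in \<open>simp add: set_borel_measurable_def\<close>)

lemma set_borel_measurable_arith:
  fixes u v :: "real \<Rightarrow> real"
  assumes "set_borel_measurable lebesgue J u" "set_borel_measurable lebesgue J v"
  shows "set_borel_measurable lebesgue J (\<lambda>x. u x * v x)"
    and "set_borel_measurable lebesgue J (\<lambda>x. u x - v x)"
    and "set_borel_measurable lebesgue J (\<lambda>x. u x + v x)"
proof -
  have "(\<lambda>x. (indicator J x *\<^sub>R u x) * (indicator J x *\<^sub>R v x)) \<in> borel_measurable lebesgue"
    "(\<lambda>x. (indicator J x *\<^sub>R u x) - (indicator J x *\<^sub>R v x)) \<in> borel_measurable lebesgue"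
    "(\<lambda>x. (indicator J x *\<^sub>R u x) + (indicator J x *\<^sub>R v x)) \<in> borel_measurable lebesgue"
    using assms by (auto simp: set_borel_measurable_def)
  moreover have "(indicator J x *\<^sub>R u x) * (indicator J x *\<^sub>R v x) = indicator J x *\<^sub>R (u x * v x)" for x
    by (simp add: indicator_def)
  moreover have "(indicator J x *\<^sub>R u x) - (indicator J x *\<^sub>R v x) = indicator J x *\<^sub>R (u x - v x)" for x
    by (simp add: indicator_def)
  moreover have "(indicator J x *\<^sub>R u x) + (indicator J x *\<^sub>R v x) = indicator J x *\<^sub>R (u x + v x)" for x
    by (simp add: indicator_def)
  ultimately show "set_borel_measurable lebesgue J (\<lambda>x. u x * v x)"
    and "set_borel_measurable lebesgue J (\<lambda>x. u x - v x)"
    and "set_borel_measurable lebesgue J (\<lambda>x. u x + v x)"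
    by (simp_all only: set_borel_measurable_def)
qed

lemma set_borel_measurable_borel:
  fixes u :: "real \<Rightarrow> real"
  assumes "u \<in> borel_measurable borel" "open J"
  shows "set_borel_measurable lebesgue J u"
proof -
  have "u \<in> borel_measurable lebesgue" "J \<in> sets lebesgue"
    using assms by (auto intro: measurable_completion)
  then show ?thesis unfolding set_borel_measurable_def by measurable
qed

text \<open>On the countable exceptional set the limit function is given the value \<open>0\<close>, so that it is a limit of
measurable functions everywhere.\<close>

lemma set_borel_measurable_limit:
  fixes w :: "nat \<Rightarrow> real \<Rightarrow> real"
  assumes "open J" "countable E" "\<And>n. set_borel_measurable lebesgue J (w n)"
    and lim: "\<And>x. x \<in> J - E \<Longrightarrow> (\<lambda>n. w n x) \<longlonglongrightarrow> z x" and zero: "\<And>x. x \<in> J \<inter> E \<Longrightarrow> z x = 0"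
  shows "set_borel_measurable lebesgue J z"
  unfolding set_borel_measurable_def
proof (rule borel_measurable_LIMSEQ_real)
  show "(\<lambda>n. indicat_real (- E) x * (indicat_real J x *\<^sub>R w n x)) \<longlonglongrightarrow> indicat_real J x *\<^sub>R z x" for x
    using lim[of x] zero[of x] by (auto simp: indicator_def)
  have "E \<in> sets lebesgue" using assms(2) countable_imp_null_set_lborel by blast
  then show "(\<lambda>x. indicat_real (- E) x * (indicat_real J x *\<^sub>R w n x)) \<in> borel_measurable lebesgue" for n
    using assms(3)[of n] by (intro borel_measurable_times borel_measurable_indicator)
      (auto simp: set_borel_measurable_def Compl_in_sets_lebesgue)
qed

lemma test_funD:
  assumes "test_fun J \<phi>"
  shows "\<And>x. (\<phi> has_real_derivative deriv \<phi> x) (at x)" "continuous_on UNIV (deriv \<phi>)"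
    "\<And>x. x \<notin> J \<Longrightarrow> \<phi> x = 0" "\<And>x. x \<notin> J \<Longrightarrow> deriv \<phi> x = 0"
proof -
  obtain U G where UG: "UNIV \<subseteq> U" "\<And>k. Ck_on k U G" "\<And>x. x \<in> UNIV \<Longrightarrow> G x = \<phi> x"
    using assms unfolding test_fun_def smooth_on_def by blast
  then have "U = UNIV" "G = \<phi>" by auto
  then have C: "Ck_on 1 UNIV \<phi>" using UG(2) by simp
  then have "\<phi> differentiable (at x)" for x by simp
  then show d: "(\<phi> has_real_derivative deriv \<phi> x) (at x)" for x
    by (simp add: DERIV_deriv_iff_real_differentiable)
  have fd: "frechet_derivative \<phi> (at x) 1 = deriv \<phi> x" for x
    unfolding frechet_derivative_at[OF d[unfolded has_field_derivative_def], symmetric] by simp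
  have "continuous_on UNIV (\<lambda>x. frechet_derivative \<phi> (at x) 1)"
    using C by simp
  then show "continuous_on UNIV (deriv \<phi>)" by (simp add: fd)
  have J: "closure {x. \<phi> x \<noteq> 0} \<subseteq> J" using assms by (simp add: test_fun_def)
  show "\<phi> x = 0" if "x \<notin> J" for x
    using that J closure_subset[of "{x. \<phi> x \<noteq> 0}"] by auto
  show "deriv \<phi> x = 0" if "x \<notin> J" for x
  proof -
    have "((\<lambda>_. 0) has_real_derivative 0) (at x)" by simp
    then have "(\<phi> has_real_derivative 0) (at x)"
    proof (rule has_field_derivative_transform_within_open)
      show "open (- closure {x. \<phi> x \<noteq> 0})" by auto
      show "x \<in> - closure {x. \<phi> x \<noteq> 0}" using that J by auto
      show "\<And>y. y \<in> - closure {x. \<phi> x \<noteq> 0} \<Longrightarrow> 0 = \<phi> y"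
        using closure_subset[of "{x. \<phi> x \<noteq> 0}"] by auto
    qed
    then show ?thesis by (rule DERIV_imp_deriv)
  qed
qed

lemma continuous_bounded_on:
  fixes \<psi> :: "real \<Rightarrow> real"
  assumes "continuous_on UNIV \<psi>" "bounded J"
  shows "\<exists>C\<ge>0. \<forall>x\<in>J. \<bar>\<psi> x\<bar> \<le> C"
proof -
  have "compact (\<psi> ` closure J)"
    using assms by (intro compact_continuous_image) (auto intro: continuous_on_subset)
  then obtain C where "\<And>y. y \<in> \<psi> ` closure J \<Longrightarrow> norm y \<le> C"
    by (meson bounded_iff compact_imp_bounded)
  then have "\<And>x. x \<in> J \<Longrightarrow> \<bar>\<psi> x\<bar> \<le> \<bar>C\<bar>" using closure_subset by fastforce
  then show ?thesis by (intro exI[of _ "\<bar>C\<bar>"]) auto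
qed

lemma L2_on_bounded:
  assumes "open J" "bounded J" "set_borel_measurable lebesgue J u" "\<And>x. x \<in> J \<Longrightarrow> \<bar>u x\<bar> \<le> B"
  shows "L2_on J u"
proof -
  have "\<bar>(u x)\<^sup>2\<bar> \<le> B\<^sup>2" if "x \<in> J" for x
    using power_mono[OF assms(4)[OF that], of 2] by simp
  then have "set_integrable lebesgue J (\<lambda>x. (u x)\<^sup>2)"
    using set_borel_measurable_arith(1)[OF assms(3) assms(3)] assms(1,2)
    by (intro set_integrable_bounded) (auto simp: power2_eq_square)
  with assms(3) show ?thesis by (simp add: L2_on_def)
qed

text \<open>Dominated convergence, applied to both sides of the integration by parts formula and to the two squared
\<open>L\<^sup>2\<close> distances.\<close>

lemma H1_with_deriv_limit:
  assumes J: "open J" "bounded J" and E: "countable E"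
    and H: "\<And>n. H1_with_deriv J (u n) (u' n)"
    and bound: "\<And>n x. x \<in> J \<Longrightarrow> \<bar>u n x\<bar> \<le> B" "\<And>n x. x \<in> J \<Longrightarrow> \<bar>u' n x\<bar> \<le> B"
    and lim: "\<And>x. x \<in> J \<Longrightarrow> (\<lambda>n. u n x) \<longlonglongrightarrow> v x"
    and lim': "\<And>x. x \<in> J - E \<Longrightarrow> (\<lambda>n. u' n x) \<longlonglongrightarrow> v' x"
    and zero: "\<And>x. x \<in> E \<Longrightarrow> v' x = 0"
  shows "H1_with_deriv J v v'" "H1_tendsto J u v"
proof -
  have m: "set_borel_measurable lebesgue J (u n)" "set_borel_measurable lebesgue J (u' n)" for n
    using H[of n] by (auto simp: H1_with_deriv_def L2_on_def)
  have mv: "set_borel_measurable lebesgue J v"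
    by (rule set_borel_measurable_limit[where E = "{}" and w = u]) (use J m lim in auto)
  have mv': "set_borel_measurable lebesgue J v'"
    by (rule set_borel_measurable_limit[where E = E and w = u']) (use J E m lim' zero in auto)
  have bv: "\<bar>v x\<bar> \<le> B" if "x \<in> J" for x
    using lim[OF that] bound(1)[OF that] by (intro LIMSEQ_le_const2[OF tendsto_rabs]) auto
  have bv': "\<bar>v' x\<bar> \<le> B" if "x \<in> J" for x
  proof (cases "x \<in> E")
    case False
    then show ?thesis
      using lim'[of x] bound(2) that by (intro LIMSEQ_le_const2[OF tendsto_rabs]) auto
  next
    case True
    then show ?thesis using zero bound(2)[OF that, of 0] by simp
  qed
  have weak: "(LINT x:J|lebesgue. v x * deriv \<phi> x) = - (LINT x:J|lebesgue. v' x * \<phi> x)"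
    if t: "test_fun J \<phi>" for \<phi>
  proof -
    note \<phi> = test_funD[OF t]
    have c: "continuous_on UNIV \<phi>"
      using \<phi>(1) by (meson DERIV_isCont continuous_at_imp_continuous_on)
    obtain C1 where C1: "C1 \<ge> 0" "\<And>x. x \<in> J \<Longrightarrow> \<bar>\<phi> x\<bar> \<le> C1" using continuous_bounded_on[OF c J(2)] by blast
    obtain C2 where C2: "C2 \<ge> 0" "\<And>x. x \<in> J \<Longrightarrow> \<bar>deriv \<phi> x\<bar> \<le> C2" using continuous_bounded_on[OF \<phi>(2) J(2)] by blast
    have m\<phi>: "set_borel_measurable lebesgue J \<phi>" "set_borel_measurable lebesgue J (deriv \<phi>)"
      using c \<phi>(2) J by (auto intro!: set_borel_measurable_borel borel_measurable_continuous_onI)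
    have "(\<lambda>n. LINT x:J|lebesgue. u n x * deriv \<phi> x) \<longlonglongrightarrow> (LINT x:J|lebesgue. v x * deriv \<phi> x)"
      using lim m mv m\<phi> C2 bound
      by (intro bounded_convergence_on[where E = "{}" and B = "B * C2"] J set_borel_measurable_arith)
        (auto intro!: tendsto_intros mult_mono' simp: abs_mult)
    moreover have "(\<lambda>n. - (LINT x:J|lebesgue. u' n x * \<phi> x)) \<longlonglongrightarrow> - (LINT x:J|lebesgue. v' x * \<phi> x)"
      using lim' m mv' m\<phi> C1 bound
      by (intro tendsto_minus bounded_convergence_on[where E = E and B = "B * C1"] J E set_borel_measurable_arith)
        (auto intro!: tendsto_intros mult_mono' simp: abs_mult)
    moreover have "(LINT x:J|lebesgue. u n x * deriv \<phi> x) = - (LINT x:J|lebesgue. u' n x * \<phi> x)" for n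
      using H[of n] t by (simp add: H1_with_deriv_def)
    ultimately show ?thesis by (simp add: LIMSEQ_unique)
  qed
  show v: "H1_with_deriv J v v'"
    unfolding H1_with_deriv_def using weak J mv mv' bv bv' by (auto intro: L2_on_bounded)
  have sq: "\<bar>(a - b)\<^sup>2\<bar> \<le> (2 * B)\<^sup>2" if "\<bar>a\<bar> \<le> B" "\<bar>b\<bar> \<le> B" for a b
  proof -
    have "\<bar>a - b\<bar> \<le> 2 * B" using that by arith
    from power_mono[OF this, of 2] show ?thesis by simp
  qed
  have sqm: "set_borel_measurable lebesgue J (\<lambda>x. (w x - z x)\<^sup>2)"
    if "set_borel_measurable lebesgue J w" "set_borel_measurable lebesgue J z" for w z :: "real \<Rightarrow> real"
    using set_borel_measurable_arith(1)[OF set_borel_measurable_arith(2)[OF that] set_borel_measurable_arith(2)[OF that]]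
    by (simp add: power2_eq_square)
  have zero_lim: "(\<lambda>n. (w n - a)\<^sup>2) \<longlonglongrightarrow> 0" if "w \<longlonglongrightarrow> a" for w :: "nat \<Rightarrow> real" and a
    using tendsto_power[OF tendsto_diff[OF that tendsto_const[of a]], of 2] by simp
  have "(\<lambda>n. LINT x:J|lebesgue. (u n x - v x)\<^sup>2) \<longlonglongrightarrow> (LINT x:J|lebesgue. 0)"
    using lim m mv bound bv
    by (intro bounded_convergence_on[where E = "{}" and B = "(2 * B)\<^sup>2"] J sqm sq zero_lim)
      (auto simp: set_borel_measurable_def)
  moreover have "(\<lambda>n. LINT x:J|lebesgue. (u' n x - v' x)\<^sup>2) \<longlonglongrightarrow> (LINT x:J|lebesgue. 0)"
    using lim' m mv' bound bv'
    by (intro bounded_convergence_on[where E = E and B = "(2 * B)\<^sup>2"] J E sqm sq zero_lim)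
      (auto simp: set_borel_measurable_def)
  ultimately have "(\<lambda>n. (LINT x:J|lebesgue. (u n x - v x)\<^sup>2) + (LINT x:J|lebesgue. (u' n x - v' x)\<^sup>2)) \<longlonglongrightarrow> 0 + 0"
    by (intro tendsto_add) (auto simp: set_lebesgue_integral_def)
  then show "H1_tendsto J u v"
    unfolding H1_tendsto_def using H v by auto
qed

text \<open>The fundamental theorem of calculus on \<open>[0, D]\<close>, with finitely many exceptional points, applied to \<open>u \<phi>\<close>. The
boundary terms vanish because a test function on \<open>J\<close> is zero at \<open>0\<close> and \<open>D\<close>.\<close>

lemma H1_with_deriv_piecewise:
  assumes J: "open J" "J \<subseteq> {0<..<D}" and D: "0 \<le> D" and E: "finite E"
    and cont: "continuous_on {0..D} u"
    and deriv: "\<And>x. x \<in> {0<..<D} - E \<Longrightarrow> (u has_real_derivative u' x) (at x)"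
    and meas: "u \<in> borel_measurable borel" "u' \<in> borel_measurable borel"
    and bound: "\<And>x. x \<in> J \<Longrightarrow> \<bar>u x\<bar> \<le> B" "\<And>x. x \<in> J \<Longrightarrow> \<bar>u' x\<bar> \<le> B"
  shows "H1_with_deriv J u u'"
proof -
  have bJ: "bounded J" using bounded_subset[OF bounded_box[of 0 D]] J(2) by (simp add: box_real)
  have m: "set_borel_measurable lebesgue J u" "set_borel_measurable lebesgue J u'"
    using meas J(1) by (auto intro: set_borel_measurable_borel)
  have "(LINT x:J|lebesgue. u x * deriv \<phi> x) = - (LINT x:J|lebesgue. u' x * \<phi> x)"
    if t: "test_fun J \<phi>" for \<phi>
  proof -
    note \<phi> = test_funD[OF t]
    have c: "continuous_on UNIV \<phi>"
      using \<phi>(1) by (meson DERIV_isCont continuous_at_imp_continuous_on)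
    obtain C1 where C1: "C1 \<ge> 0" "\<And>x. x \<in> J \<Longrightarrow> \<bar>\<phi> x\<bar> \<le> C1" using continuous_bounded_on[OF c bJ] by blast
    obtain C2 where C2: "C2 \<ge> 0" "\<And>x. x \<in> J \<Longrightarrow> \<bar>deriv \<phi> x\<bar> \<le> C2" using continuous_bounded_on[OF \<phi>(2) bJ] by blast
    have m\<phi>: "set_borel_measurable lebesgue J \<phi>" "set_borel_measurable lebesgue J (deriv \<phi>)"
      using c \<phi>(2) J by (auto intro!: set_borel_measurable_borel borel_measurable_continuous_onI)
    have i1: "set_integrable lebesgue J (\<lambda>x. u x * deriv \<phi> x)"
      using m m\<phi> C2 bound
      by (intro set_integrable_bounded[where B = "B * C2"] J bJ set_borel_measurable_arith)
        (auto intro!: mult_mono' simp: abs_mult)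
    have i2: "set_integrable lebesgue J (\<lambda>x. u' x * \<phi> x)"
      using m m\<phi> C1 bound
      by (intro set_integrable_bounded[where B = "B * C1"] J bJ set_borel_measurable_arith)
        (auto intro!: mult_mono' simp: abs_mult)
    let ?g = "\<lambda>x. u x * deriv \<phi> x + u' x * \<phi> x"
    have "(?g has_integral (u D * \<phi> D - u 0 * \<phi> 0)) {0..D}"
    proof (rule fundamental_theorem_of_calculus_interior_strong[OF E D])
      show "((\<lambda>x. u x * \<phi> x) has_vector_derivative ?g x) (at x)" if "x \<in> {0<..<D} - E" for x
        using DERIV_mult[OF deriv[OF that] \<phi>(1)]
        by (simp add: has_real_derivative_iff_has_vector_derivative[symmetric] add.commute mult.commute)
      show "continuous_on {0..D} (\<lambda>x. u x * \<phi> x)"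
        using c by (intro continuous_on_mult cont) (auto intro: continuous_on_subset)
    qed
    moreover have "\<phi> 0 = 0" "\<phi> D = 0" using J(2) by (auto intro!: \<phi>(3))
    ultimately have "(?g has_integral 0) {0..D}" by simp
    then have "integral {0..D} ?g = 0" by (rule integral_unique)
    moreover have "indicat_real J x *\<^sub>R ?g x = indicat_real {0..D} x *\<^sub>R ?g x" for x
      using J(2) \<phi>(3,4)[of x] by (auto simp: indicator_def)
    moreover have "set_integrable lebesgue J ?g" by (intro set_integral_add i1 i2)
    ultimately have "set_integrable lebesgue {0..D} ?g" "(LINT x:J|lebesgue. ?g x) = (LINT x:{0..D}|lebesgue. ?g x)"
      by (simp_all only: set_integrable_def set_lebesgue_integral_def)
    then have "(LINT x:J|lebesgue. ?g x) = 0"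
      using \<open>integral {0..D} ?g = 0\<close> set_lebesgue_integral_eq_integral(2) by metis
    then show ?thesis using set_integral_add(2)[OF i1 i2] by simp
  qed
  then show ?thesis
    using L2_on_bounded[OF J(1) bJ m(1) bound(1)] L2_on_bounded[OF J(1) bJ m(2) bound(2)]
    by (simp add: H1_with_deriv_def)
qed

section \<open>Warping functions\<close>

lemma mvt_real:
  fixes p p' :: "real \<Rightarrow> real"
  assumes "a < b" "continuous_on {a..b} p" "\<And>x. x \<in> {a<..<b} \<Longrightarrow> (p has_real_derivative p' x) (at x)"
  shows "\<exists>z>a. z < b \<and> p b - p a = (b - a) * p' z"
proof -
  obtain z where "z \<in> {a<..<b}" "p b - p a = p' z * (b - a)"
    using mvt[OF assms(1,2), of "\<lambda>x h. p' x * h"] assms(3) by (auto simp: has_field_derivative_def)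
  then show ?thesis by (auto simp: mult.commute)
qed

text \<open>If \<open>p x > 1\<close>, go back from \<open>x\<close> to the last point \<open>y\<close> with \<open>p y \<le> 1\<close>. Between \<open>y\<close> and \<open>x\<close> the function
decreases, which contradicts \<open>p y \<le> 1 < p x\<close>.\<close>

lemma le_one_if_decreasing_above_one:
  fixes p p' :: "real \<Rightarrow> real"
  assumes cont: "continuous_on {0..l} p" and p0: "p 0 \<le> 1"
    and deriv: "\<And>x. x \<in> {0<..<l} \<Longrightarrow> (p has_real_derivative p' x) (at x)"
    and dec: "\<And>x. x \<in> {0<..<l} \<Longrightarrow> 1 < p x \<Longrightarrow> p' x < 0"
    and x: "x \<in> {0<..<l}"
  shows "p x \<le> 1"
proof (rule ccontr)
  assume px: "\<not> p x \<le> 1"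
  have "closed {y \<in> {0..x}. p y \<le> 1}"
    using x by (intro continuous_on_closed_Collect_le continuous_on_subset[OF cont]) auto
  moreover have "bounded {y \<in> {0..x}. p y \<le> 1}"
    by (rule bounded_subset[of "{0..x}"]) auto
  ultimately have "compact {y \<in> {0..x}. p y \<le> 1}" by (simp add: compact_eq_bounded_closed)
  moreover have "0 \<in> {y \<in> {0..x}. p y \<le> 1}" using p0 x by simp
  ultimately have "\<exists>y\<in>{y \<in> {0..x}. p y \<le> 1}. \<forall>z\<in>{y \<in> {0..x}. p y \<le> 1}. z \<le> y"
    by (intro compact_attains_sup) auto
  then obtain y where y: "y \<in> {0..x}" "p y \<le> 1" "\<And>z. z \<in> {0..x} \<Longrightarrow> p z \<le> 1 \<Longrightarrow> z \<le> y"
    by blast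
  have "y < x" using y px by (cases "y = x") auto
  have "\<exists>z>y. z < x \<and> p x - p y = (x - y) * p' z"
    using \<open>y < x\<close> y(1) x
    by (intro mvt_real continuous_on_subset[OF cont] deriv) auto
  then obtain z where z: "y < z" "z < x" "p x - p y = (x - y) * p' z" by blast
  then have "1 < p z" using y(3)[of z] y(1) by force
  then have "p' z < 0" using z y(1) x by (intro dec) auto
  then have "p x < p y" using z(3) mult_pos_neg[of "x - y" "p' z"] \<open>y < x\<close> by simp
  then show False using y(2) px by simp
qed

text \<open>The derivative of \<open>zero_ext l f\<close> away from the end points; at the possible kink \<open>l\<close> the value \<open>0\<close> is a convention.\<close>

definition zero_ext' :: "real \<Rightarrow> (real \<Rightarrow> real) \<Rightarrow> real \<Rightarrow> real" where
  "zero_ext' l f' s = (if s \<in> {0<..<l} then f' s else 0)"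

text \<open>What the analysis uses of a rotationally symmetric metric: the boundary values of the warping function and
the scalar curvature inequality.\<close>

locale warping =
  fixes l :: real and f f' f'' :: "real \<Rightarrow> real"
  assumes l_pos: "0 < l" and f_0: "f 0 = 0" and f_l: "f l = 0"
    and f_pos: "\<And>s. s \<in> {0<..<l} \<Longrightarrow> 0 < f s"
    and cont: "continuous_on {0..l} f" and cont': "continuous_on {0..l} f'"
    and deriv: "\<And>s. s \<in> {0<..<l} \<Longrightarrow> (f has_real_derivative f' s) (at s)"
    and deriv2: "\<And>s. s \<in> {0<..<l} \<Longrightarrow> (f' has_real_derivative f'' s) (at s)"
    and f'_0: "f' 0 = 1" and f'_l: "f' l = -1"
    and curv: "\<And>s. s \<in> {0<..<l} \<Longrightarrow> 2 * f s * f'' s \<le> 1 - (f' s)\<^sup>2"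
begin

lemma second_deriv_neg:
  assumes s: "s \<in> {0<..<l}" and "1 < \<bar>f' s\<bar>" shows "f'' s < 0"
proof -
  have "1 < (f' s)\<^sup>2" using one_less_power[OF assms(2), of 2] by simp
  then have "2 * f s * f'' s < 0" using curv[OF s] by simp
  then show ?thesis using f_pos[OF s] by (auto simp: mult_less_0_iff)
qed

text \<open>The upper bound follows from \<open>le_one_if_decreasing_above_one\<close>, since \<open>f'\<close> starts at \<open>1\<close>; the lower bound is the
upper bound for the reversed function \<open>f (l - x)\<close>.\<close>

lemma deriv_le_one:
  assumes s: "s \<in> {0<..<l}" shows "\<bar>f' s\<bar> \<le> 1"
proof -
  have "f' s \<le> 1"
  proof (rule le_one_if_decreasing_above_one[where p = f' and p' = f'', OF cont' _ deriv2])
    show "f'' x < 0" if "x \<in> {0<..<l}" "1 < f' x" for x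
      using that(2) by (intro second_deriv_neg that(1)) simp
  qed (use s f'_0 in auto)
  moreover have "- f' (l - (l - s)) \<le> 1"
  proof (rule le_one_if_decreasing_above_one[where p = "\<lambda>x. - f' (l - x)" and p' = "\<lambda>x. f'' (l - x)" and l = l])
    show "continuous_on {0..l} (\<lambda>x. - f' (l - x))"
      by (intro continuous_intros continuous_on_compose2[OF cont']) auto
    show "((\<lambda>x. - f' (l - x)) has_real_derivative f'' (l - x)) (at x)" if "x \<in> {0<..<l}" for x
    proof -
      have "(f' has_real_derivative f'' (l - x)) (at (l - x))" using that by (intro deriv2) auto
      moreover have "((\<lambda>x. l - x) has_real_derivative -1) (at x)"
        by (auto intro!: derivative_eq_intros)
      ultimately have "((\<lambda>x. - f' (l - x)) has_real_derivative - (f'' (l - x) * - 1)) (at x)"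
        by (intro DERIV_minus DERIV_chain2)
      then show ?thesis by simp
    qed
    show "f'' (l - x) < 0" if "x \<in> {0<..<l}" "1 < - f' (l - x)" for x
    proof (rule second_deriv_neg)
      show "l - x \<in> {0<..<l}" using that(1) by auto
      show "1 < \<bar>f' (l - x)\<bar>" using that(2) by linarith
    qed
  qed (use s f'_l in auto)
  ultimately show ?thesis by simp
qed

lemma zero_ext_pos_iff: "0 < zero_ext l f s \<longleftrightarrow> s \<in> {0<..<l}"
  using f_0 f_l f_pos[of s] by (cases "s = 0 \<or> s = l") (auto simp: zero_ext_def)

lemma zero_ext_nonneg: "0 \<le> zero_ext l f s"
  using f_0 f_l f_pos[of s] by (cases "s = 0 \<or> s = l") (auto simp: zero_ext_def less_imp_le)

lemma abs_zero_ext'_le: "\<bar>zero_ext' l f' s\<bar> \<le> 1"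
  using deriv_le_one by (simp add: zero_ext'_def)

lemma continuous_zero_ext: "continuous_on {0..D} (zero_ext l f)"
proof -
  have "continuous_on ({0..l} \<union> {l..}) (zero_ext l f)"
  proof (rule continuous_on_closed_Un)
    show "continuous_on {0..l} (zero_ext l f)"
      using cont by (rule continuous_on_eq) (simp add: zero_ext_def)
    have "continuous_on {l..} (\<lambda>_. 0::real)" by simp
    then show "continuous_on {l..} (zero_ext l f)"
      by (rule continuous_on_eq) (use f_l in \<open>auto simp: zero_ext_def\<close>)
  qed auto
  then show ?thesis by (rule continuous_on_subset) auto
qed

lemma zero_ext_deriv:
  assumes "0 < s" "s \<noteq> l"
  shows "(zero_ext l f has_real_derivative zero_ext' l f' s) (at s)"
proof (cases "s < l")
  case True
  have "(f has_real_derivative f' s) (at s)" using assms True by (intro deriv) auto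
  then have "(zero_ext l f has_real_derivative f' s) (at s)"
    by (rule has_field_derivative_transform_within_open[where S = "{0<..<l}"])
      (use assms True in \<open>auto simp: zero_ext_def\<close>)
  then show ?thesis using assms True by (simp add: zero_ext'_def)
next
  case False
  have "((\<lambda>_. 0) has_real_derivative 0) (at s)" by simp
  then have "(zero_ext l f has_real_derivative 0) (at s)"
    by (rule has_field_derivative_transform_within_open[where S = "{l<..}"])
      (use assms False in \<open>auto simp: zero_ext_def\<close>)
  then show ?thesis using False by (simp add: zero_ext'_def)
qed

lemma zero_ext_le:
  assumes s: "0 \<le> s" shows "zero_ext l f s \<le> s"
proof (cases "s \<in> {0<..<l}")
  case True
  have "\<exists>z>0. z < s \<and> f s - f 0 = (s - 0) * f' z"
    using True by (intro mvt_real continuous_on_subset[OF cont] deriv) auto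
  then obtain z where z: "0 < z" "z < s" "f s = s * f' z" using f_0 by auto
  then have "f s \<le> s * 1"
    using deriv_le_one[of z] True by (intro order.trans[OF eq_refl[OF z(3)] mult_left_mono]) auto
  then show ?thesis using True by (simp add: zero_ext_def)
next
  case False
  then have "zero_ext l f s \<le> 0" using zero_ext_pos_iff[of s] by (metis linorder_not_less)
  then show ?thesis using s by simp
qed

lemma measurable_zero_ext: "zero_ext l f \<in> borel_measurable borel"
proof -
  have "(\<lambda>x. indicator {0..l} x *\<^sub>R f x) \<in> borel_measurable borel"
    using cont by (intro borel_measurable_continuous_on_indicator) auto
  moreover have "zero_ext l f = (\<lambda>x. indicator {0..l} x *\<^sub>R f x)"
    by (auto simp: zero_ext_def indicator_def)
  ultimately show ?thesis by simp
qed

lemma measurable_zero_ext': "zero_ext' l f' \<in> borel_measurable borel"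
proof -
  have "(\<lambda>x. indicator {0<..<l} x *\<^sub>R f' x) \<in> borel_measurable borel"
    using cont' by (intro borel_measurable_continuous_on_indicator) (auto intro: continuous_on_subset)
  moreover have "zero_ext' l f' = (\<lambda>x. indicator {0<..<l} x *\<^sub>R f' x)"
    by (auto simp: zero_ext'_def indicator_def)
  ultimately show ?thesis by simp
qed

lemma H1_zero_ext:
  assumes "open J" "J \<subseteq> {0<..<D}" "0 \<le> D" "D \<le> B" "1 \<le> B"
  shows "H1_with_deriv J (zero_ext l f) (zero_ext' l f')"
proof (rule H1_with_deriv_piecewise[where E = "{l}" and B = B])
  show "\<bar>zero_ext l f x\<bar> \<le> B" if "x \<in> J" for x
    using zero_ext_le[of x] zero_ext_nonneg[of x] that assms by fastforce
  show "\<bar>zero_ext' l f' x\<bar> \<le> B" for x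
    using abs_zero_ext'_le[of x] assms by linarith
qed (use assms in \<open>auto intro!: continuous_zero_ext zero_ext_deriv measurable_zero_ext measurable_zero_ext'\<close>)

lemma zero_ext_powr_deriv:
  assumes "0 < s" "s \<noteq> l"
  shows "((\<lambda>s. zero_ext l f s powr (3/2)) has_real_derivative
     3/2 * (zero_ext l f s powr (1/2) * zero_ext' l f' s)) (at s)"
proof (cases "s < l")
  case True
  then have "0 < zero_ext l f s" using assms by (simp add: zero_ext_pos_iff)
  from DERIV_powr[OF zero_ext_deriv[OF assms] this DERIV_const[of "3/2"]]
  have "((\<lambda>s. zero_ext l f s powr (3/2)) has_real_derivative
      zero_ext l f s powr (3/2) * (0 * ln (zero_ext l f s) + zero_ext' l f' s * (3/2) / zero_ext l f s)) (at s)" .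
  moreover have "zero_ext l f s powr (3/2) = zero_ext l f s * zero_ext l f s powr (1/2)"
    using \<open>0 < zero_ext l f s\<close> powr_mult_base[of "zero_ext l f s" "1/2"] by simp
  ultimately show ?thesis
    using \<open>0 < zero_ext l f s\<close> by (simp add: mult_ac)
next
  case False
  have "((\<lambda>_. 0) has_real_derivative 0) (at s)" by simp
  then have "((\<lambda>s. zero_ext l f s powr (3/2)) has_real_derivative 0) (at s)"
    by (rule has_field_derivative_transform_within_open[where S = "{l<..}"])
      (use assms False in \<open>auto simp: zero_ext_def\<close>)
  then show ?thesis using False by (simp add: zero_ext'_def)
qed

lemma zero_ext_powr_bounds:
  assumes "0 \<le> s" "s \<le> B" "1 \<le> B"
  shows "\<bar>zero_ext l f s powr (3/2)\<bar> \<le> 2 * B powr (3/2)"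
    "\<bar>3/2 * (zero_ext l f s powr (1/2) * zero_ext' l f' s)\<bar> \<le> 2 * B powr (3/2)"
proof -
  have z: "zero_ext l f s \<le> B" "0 \<le> zero_ext l f s"
    using zero_ext_le[of s] zero_ext_nonneg[of s] assms by auto
  have 1: "zero_ext l f s powr a \<le> B powr (3/2)" if "0 < a" "a \<le> 3/2" for a
    using powr_mono2[of a "zero_ext l f s" B] powr_mono[of a "3/2" B] z that assms by linarith
  show "\<bar>zero_ext l f s powr (3/2)\<bar> \<le> 2 * B powr (3/2)"
    using 1[of "3/2"] powr_ge_zero[of "zero_ext l f s" "3/2"] by linarith
  have "\<bar>zero_ext l f s powr (1/2) * zero_ext' l f' s\<bar> \<le> B powr (3/2) * 1"
    unfolding abs_mult using 1[of "1/2"] abs_zero_ext'_le[of s] by (intro mult_mono) auto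
  then show "\<bar>3/2 * (zero_ext l f s powr (1/2) * zero_ext' l f' s)\<bar> \<le> 2 * B powr (3/2)"
    using powr_ge_zero[of B "3/2"] by linarith
qed

lemma H1_zero_ext_powr:
  assumes "open J" "J \<subseteq> {0<..<D}" "0 \<le> D" "D \<le> B" "1 \<le> B"
  shows "H1_with_deriv J (\<lambda>s. zero_ext l f s powr (3/2)) (\<lambda>s. 3/2 * (zero_ext l f s powr (1/2) * zero_ext' l f' s))"
proof (rule H1_with_deriv_piecewise[where E = "{l}" and B = "2 * B powr (3/2)"])
  show "\<bar>zero_ext l f x powr (3/2)\<bar> \<le> 2 * B powr (3/2)"
    "\<bar>3/2 * (zero_ext l f x powr (1/2) * zero_ext' l f' x)\<bar> \<le> 2 * B powr (3/2)" if "x \<in> J" for x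
  proof -
    have "0 \<le> x" "x \<le> B" using that assms by fastforce+
    then show "\<bar>zero_ext l f x powr (3/2)\<bar> \<le> 2 * B powr (3/2)"
      "\<bar>3/2 * (zero_ext l f x powr (1/2) * zero_ext' l f' x)\<bar> \<le> 2 * B powr (3/2)"
      using assms(5) by (rule zero_ext_powr_bounds)+
  qed
  show "continuous_on {0..D} (\<lambda>s. zero_ext l f s powr (3/2))"
    using zero_ext_nonneg by (intro continuous_on_powr' continuous_zero_ext) auto
  show "(\<lambda>s. zero_ext l f s powr (3/2)) \<in> borel_measurable borel"
    "(\<lambda>s. 3/2 * (zero_ext l f s powr (1/2) * zero_ext' l f' s)) \<in> borel_measurable borel"
    using measurable_zero_ext measurable_zero_ext' by measurable
  show "((\<lambda>s. zero_ext l f s powr (3/2)) has_real_derivative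
     3/2 * (zero_ext l f x powr (1/2) * zero_ext' l f' x)) (at x)" if "x \<in> {0<..<D} - {l}" for x
    using that by (intro zero_ext_powr_deriv) auto
qed (use assms in auto)

end

text \<open>On a compact interval in \<open>{a<..<b}\<close> with minimum \<open>m\<close> of \<open>F\<close>, for large \<open>n\<close> the functions \<open>f n\<close> exceed \<open>m / 2\<close>, and
the curvature inequality gives \<open>f'' n \<le> 1 / (2 f n) \<le> 1 / m\<close>. So \<open>f n - s\<^sup>2 / (2 m)\<close> is concave, and
\<open>concave_derivatives_converge\<close> applies. Countably many such intervals, with rational end points, exhaust
\<open>{a<..<b}\<close>.\<close>

lemma warping_derivatives_converge:
  assumes W: "\<And>n. warping (L n) (f n) (f' n) (f'' n)"
    and lim: "uniform_limit {0..D} (\<lambda>n. zero_ext (L n) (f n)) F sequentially"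
    and I: "{a<..<b} \<subseteq> {0..D}" and pos: "\<And>s. s \<in> {a<..<b} \<Longrightarrow> 0 < F s"
  shows "\<exists>E. countable E \<and> (\<forall>s\<in>{a<..<b} - E. convergent (\<lambda>n. zero_ext' (L n) (f' n) s))"
proof -
  have contF: "continuous_on {0..D} F"
    using warping.continuous_zero_ext[OF W]
    by (intro uniform_limit_theorem[OF _ lim]) (auto intro!: always_eventually)
  have "\<exists>E. countable E \<and> (\<forall>s\<in>{c<..<d} - E. convergent (\<lambda>n. zero_ext' (L n) (f' n) s))"
    if cd: "{c..d} \<subseteq> {a<..<b}" for c d
  proof (cases "c \<le> d")
    case True
    have sub: "{c..d} \<subseteq> {0..D}" using cd I by (rule order.trans)
    obtain y where y: "y \<in> {c..d}" "\<And>s. s \<in> {c..d} \<Longrightarrow> F y \<le> F s"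
      using continuous_attains_inf[OF _ _ continuous_on_subset[OF contF sub]] True by auto
    define m where "m = F y"
    have m: "0 < m" using pos cd y(1) by (auto simp: m_def)
    have "\<forall>\<^sub>F n in sequentially. \<forall>s\<in>{0..D}. dist (zero_ext (L n) (f n) s) (F s) < m / 2"
      using m by (intro uniform_limitD[OF lim]) simp
    then obtain N where N: "\<And>n s. N \<le> n \<Longrightarrow> s \<in> {0..D} \<Longrightarrow> dist (zero_ext (L n) (f n) s) (F s) < m / 2"
      unfolding eventually_sequentially by blast
    have big: "m / 2 < zero_ext (L n) (f n) s" if "N \<le> n" "s \<in> {c..d}" for n s
    proof -
      have "\<bar>zero_ext (L n) (f n) s - F s\<bar> < m / 2"
        using N[OF that(1) subsetD[OF sub that(2)]] by (simp only: dist_real_def)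
      moreover have "m \<le> F s" using y(2)[OF that(2)] by (simp only: m_def)
      ultimately show ?thesis by linarith
    qed
    have inside: "s \<in> {0<..<L n}" if "N \<le> n" "s \<in> {c..d}" for n s
      using big[OF that] m warping.zero_ext_pos_iff[OF W, of n s] by simp
    have second: "f'' n s \<le> 1 / m" if "N \<le> n" "s \<in> {c..d}" for n s
    proof (cases "f'' n s \<le> 0")
      case False
      have fs: "m / 2 < f n s" using big[OF that] inside[OF that] by (simp add: zero_ext_def)
      have "m * f'' n s \<le> 2 * f n s * f'' n s" using fs False by (intro mult_right_mono) auto
      also have "\<dots> \<le> 1 - (f' n s)\<^sup>2" by (rule warping.curv[OF W inside[OF that]])
      also have "\<dots> \<le> 1" by simp
      finally show ?thesis using m by (simp add: field_simps)
    qed (use m in \<open>simp add: order.trans\<close>)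
    define k where "k n s = f (n + N) s - s\<^sup>2 / (2 * m)" for n s
    define k' where "k' n s = f' (n + N) s - s / m" for n s
    have "\<exists>E. countable E \<and> (\<forall>s\<in>{c<..<d} - E. convergent (\<lambda>n. k' n s))"
    proof (rule concave_derivatives_converge[where k = k and K = "\<lambda>s. F s - s\<^sup>2 / (2 * m)"])
      show "(k n has_real_derivative k' n x) (at x)" if "x \<in> {c<..<d}" for n x
      proof -
        have "(f (n + N) has_real_derivative f' (n + N) x) (at x)"
          using that inside[of "n + N" x] by (intro warping.deriv[OF W]) auto
        then show ?thesis unfolding k_def[abs_def] k'_def using m by (auto intro!: derivative_eq_intros)
      qed
      show "k' n y \<le> k' n x" if xy: "x \<in> {c<..<d}" "y \<in> {c<..<d}" "x \<le> y" for n x y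
      proof (rule DERIV_nonpos_imp_nonincreasing[OF xy(3)])
        fix t assume t: "x \<le> t" "t \<le> y"
        then have t': "t \<in> {c..d}" using xy by auto
        have "(f' (n + N) has_real_derivative f'' (n + N) t) (at t)"
          using inside[OF _ t', of "n + N"] by (intro warping.deriv2[OF W]) auto
        then have "(k' n has_real_derivative f'' (n + N) t - 1 / m) (at t)"
          unfolding k'_def[abs_def] using m by (auto intro!: derivative_eq_intros)
        moreover have "f'' (n + N) t - 1 / m \<le> 0" using second[OF _ t', of "n + N"] by simp
        ultimately show "\<exists>z. (k' n has_real_derivative z) (at t) \<and> z \<le> 0" by blast
      qed
      show "(\<lambda>n. k n x) \<longlonglongrightarrow> F x - x\<^sup>2 / (2 * m)" if x: "x \<in> {c<..<d}" for x
      proof -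
        have "(\<lambda>n. zero_ext (L n) (f n) x) \<longlonglongrightarrow> F x"
          using x sub by (intro tendsto_uniform_limitI[OF lim]) auto
        then have "(\<lambda>n. zero_ext (L (n + N)) (f (n + N)) x) \<longlonglongrightarrow> F x" by (rule LIMSEQ_ignore_initial_segment)
        moreover have "zero_ext (L (n + N)) (f (n + N)) x = f (n + N) x" for n
          using inside[of "n + N" x] x by (auto simp: zero_ext_def)
        ultimately show ?thesis unfolding k_def by (intro tendsto_intros) simp
      qed
    qed
    then obtain E where E: "countable E" "\<And>s. s \<in> {c<..<d} - E \<Longrightarrow> convergent (\<lambda>n. k' n s)" by blast
    have "convergent (\<lambda>n. zero_ext' (L n) (f' n) s)" if s: "s \<in> {c<..<d} - E" for s
    proof -
      have "zero_ext' (L (n + N)) (f' (n + N)) s = k' n s + s / m" for n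
        using inside[of "n + N" s] s by (auto simp: zero_ext'_def k'_def)
      then have "convergent (\<lambda>n. zero_ext' (L (n + N)) (f' (n + N)) s)"
        using convergent_add[OF E(2)[OF s] convergent_const[of "s / m"]] by simp
      then show ?thesis using convergent_ignore_initial_segment[of "\<lambda>n. zero_ext' (L n) (f' n) s" N] by simp
    qed
    with E(1) show ?thesis by blast
  qed auto
  note local = this
  define R where "R = {p \<in> \<rat> \<times> \<rat>. {fst p..snd p} \<subseteq> {a<..<b}}"
  have "\<forall>p\<in>R. \<exists>E. countable E \<and> (\<forall>s\<in>{fst p<..<snd p} - E. convergent (\<lambda>n. zero_ext' (L n) (f' n) s))"
    using local by (simp add: R_def)
  from bchoice[OF this] obtain E where
    "\<forall>p\<in>R. countable (E p) \<and> (\<forall>s\<in>{fst p<..<snd p} - E p. convergent (\<lambda>n. zero_ext' (L n) (f' n) s))" ..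
  then have E: "\<And>p. p \<in> R \<Longrightarrow> countable (E p)"
    "\<And>p s. p \<in> R \<Longrightarrow> s \<in> {fst p<..<snd p} - E p \<Longrightarrow> convergent (\<lambda>n. zero_ext' (L n) (f' n) s)"
    by auto
  have "R \<subseteq> \<rat> \<times> \<rat>" by (auto simp: R_def)
  then have "countable R" by (rule countable_subset) (intro countable_SIGMA countable_rat)
  then have "countable (\<Union>p\<in>R. E p)" using E(1) by (rule countable_UN)
  moreover have "convergent (\<lambda>n. zero_ext' (L n) (f' n) s)" if s: "s \<in> {a<..<b} - (\<Union>p\<in>R. E p)" for s
  proof -
    have "\<exists>c\<in>\<rat>. a < c \<and> c < s" "\<exists>d\<in>\<rat>. s < d \<and> d < b"
      using s by (auto intro!: Rats_dense_in_real)
    then obtain c d where c: "c \<in> \<rat>" "a < c" "c < s" and d: "d \<in> \<rat>" "s < d" "d < b"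
      by blast
    then have "(c, d) \<in> R" by (auto simp: R_def)
    then show ?thesis using s c d by (intro E(2)[of "(c, d)"]) auto
  qed
  ultimately show ?thesis by blast
qed

text \<open>A function that is smooth on the closed interval extends smoothly to a neighbourhood, so the derivative of
the extension is continuous up to the end points, and there it agrees with the one-sided derivatives.\<close>

lemma smooth_warping_derivatives:
  fixes f :: "real \<Rightarrow> real"
  assumes sm: "smooth_on {0..l} f" and l: "0 < l"
    and d0: "(f has_real_derivative 1) (at 0 within {0..l})"
    and dl: "(f has_real_derivative -1) (at l within {0..l})"
  shows "\<exists>f' f''. continuous_on {0..l} f \<and> continuous_on {0..l} f' \<and> f' 0 = 1 \<and> f' l = -1 \<and>
    (\<forall>s\<in>{0<..<l}. (f has_real_derivative f' s) (at s) \<and> (f' has_real_derivative f'' s) (at s))"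
proof -
  obtain U G where U: "{0..l} \<subseteq> U" and G: "\<And>k. Ck_on k U G" "\<And>x. x \<in> {0..l} \<Longrightarrow> G x = f x"
    using sm unfolding smooth_on_def by blast
  define f' where "f' x = frechet_derivative G (at x) 1" for x
  define f'' where "f'' x = frechet_derivative f' (at x) 1" for x
  have "Ck_on (Suc (Suc 0)) U G" by (rule G(1))
  then have dG: "\<And>x. x \<in> U \<Longrightarrow> G differentiable at x" "\<And>x. x \<in> U \<Longrightarrow> f' differentiable at x"
    by (auto simp: f'_def[abs_def])
  have real: "(h has_real_derivative frechet_derivative h (at x) 1) (at x)" if "h differentiable at x" for h :: "real \<Rightarrow> real" and x
  proof -
    have "(h has_derivative frechet_derivative h (at x)) (at x)" using that by (simp add: frechet_derivative_works)
    moreover have "frechet_derivative h (at x) = (*) (frechet_derivative h (at x) 1)"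
    proof (rule ext)
      fix t :: real
      have "linear (frechet_derivative h (at x))" using that by (rule linear_frechet_derivative)
      from linear_scale[OF this, of t 1] show "frechet_derivative h (at x) t = frechet_derivative h (at x) 1 * t"
        by simp
    qed
    ultimately show ?thesis unfolding has_field_derivative_def by (rule has_derivative_eq_rhs)
  qed
  have G': "(G has_real_derivative f' x) (at x)" if "x \<in> U" for x
    unfolding f'_def using dG(1)[OF that] by (rule real)
  have fw: "(f has_real_derivative f' x) (at x within {0..l})" if "x \<in> {0..l}" for x
  proof -
    have "(G has_real_derivative f' x) (at x within {0..l})"
      by (rule has_field_derivative_at_within[OF G'[OF subsetD[OF U that]]])
    then show ?thesis
      by (rule has_field_derivative_transform_within[of _ _ _ _ 1]) (use that G(2) in auto)
  qed
  show ?thesis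
  proof (rule exI[of _ f'], rule exI[of _ f''], intro conjI ballI)
    show "continuous_on {0..l} f" by (rule DERIV_continuous_on[OF fw])
    show "continuous_on {0..l} f'"
      using dG(2) U by (intro continuous_at_imp_continuous_on ballI differentiable_imp_continuous_within) auto
    show "f' 0 = 1"
      using vector_derivative_unique_within[of 0 "{0..l}" f "f' 0" 1] fw[of 0] d0 l
      by (simp add: has_real_derivative_iff_has_vector_derivative trivial_limit_within islimpt_Icc)
    show "f' l = -1"
      using vector_derivative_unique_within[of l "{0..l}" f "f' l" "-1"] fw[of l] dl l
      by (simp add: has_real_derivative_iff_has_vector_derivative trivial_limit_within islimpt_Icc)
    fix s assume s: "s \<in> {0<..<l}"
    show "(f has_real_derivative f' s) (at s)"
      using fw[of s] at_within_Icc_at[of 0 s l] s by simp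
    have "s \<in> U" using subsetD[OF U, of s] s by simp
    from real[OF dG(2)[OF this]] show "(f' has_real_derivative f'' s) (at s)" unfolding f''_def .
  qed
qed

section \<open>Convergence of warping functions\<close>

text \<open>The limits enter only through their values on \<open>{a<..<b}\<close>; \<open>u\<close> and \<open>v\<close> are arbitrary elsewhere, because
functions on the whole line represent elements of \<open>H1 J\<close>.\<close>

lemma warping_H1_limits:
  fixes F u v :: "real \<Rightarrow> real"
  assumes W: "\<And>n. warping (L n) (f n) (f' n) (f'' n)" and D: "0 \<le> D"
    and lim: "uniform_limit {0..D} (\<lambda>n. zero_ext (L n) (f n)) F sequentially"
    and I: "{a<..<b} \<subseteq> {0<..<D}" and pos: "\<And>s. s \<in> {a<..<b} \<Longrightarrow> 0 < F s"
    and J: "open J" "J \<subseteq> {a<..<b}"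
    and u: "\<And>s. s \<in> {a<..<b} \<Longrightarrow> u s = F s" and v: "\<And>s. s \<in> {a<..<b} \<Longrightarrow> v s = F s powr (3/2)"
  shows "u \<in> H1 J" "H1_tendsto J (\<lambda>n. zero_ext (L n) (f n)) u"
    and "v \<in> H1 J" "H1_tendsto J (\<lambda>n s. zero_ext (L n) (f n) s powr (3/2)) v"
proof -
  have I': "{a<..<b} \<subseteq> {0..D}" using I by (rule order.trans) auto
  obtain E where E: "countable E" "\<And>s. s \<in> {a<..<b} - E \<Longrightarrow> convergent (\<lambda>n. zero_ext' (L n) (f' n) s)"
    using warping_derivatives_converge[OF W lim I' pos] by blast
  define B where "B = max D 1"
  \<comment> \<open>The weak derivative of \<open>u\<close>; outside \<open>E\<close> it is the limit of the derivatives.\<close>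
  define w where "w s = (if s \<in> E then 0 else Topological_Spaces.lim (\<lambda>n. zero_ext' (L n) (f' n) s))" for s
  have bJ: "bounded J" using bounded_subset[OF bounded_box[of a b]] J(2) by (simp add: box_real)
  have J': "J \<subseteq> {0<..<D}" using J(2) I by (rule order.trans)
  have B: "D \<le> B" "1 \<le> B" by (auto simp: B_def)
  have pt: "(\<lambda>n. zero_ext (L n) (f n) s) \<longlonglongrightarrow> F s" if "s \<in> J" for s
    by (rule tendsto_uniform_limitI[OF lim]) (use that J' in auto)
  have pt': "(\<lambda>n. zero_ext' (L n) (f' n) s) \<longlonglongrightarrow> w s" if "s \<in> J - E" for s
    using E(2)[of s] that J(2) by (auto simp: w_def convergent_LIMSEQ_iff)
  have bds: "0 \<le> s" "s \<le> B" if "s \<in> J" for s using that J' B(1) by fastforce+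
  have H: "H1_with_deriv J (zero_ext (L n) (f n)) (zero_ext' (L n) (f' n))" for n
    by (rule warping.H1_zero_ext[OF W J(1) J' D B])
  have b: "\<bar>zero_ext (L n) (f n) s\<bar> \<le> B" "\<bar>zero_ext' (L n) (f' n) s\<bar> \<le> B" if "s \<in> J" for n s
    using warping.zero_ext_le[OF W, of s n] warping.zero_ext_nonneg[OF W, of n s] bds[OF that]
      warping.abs_zero_ext'_le[OF W, of n s] B(2) by linarith+
  have p: "(\<lambda>n. zero_ext (L n) (f n) s) \<longlonglongrightarrow> u s" if "s \<in> J" for s
    using pt[OF that] u[of s] that J(2) by auto
  have z: "w s = 0" if "s \<in> E" for s using that by (simp add: w_def)
  have "H1_with_deriv J u w" "H1_tendsto J (\<lambda>n. zero_ext (L n) (f n)) u"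
    by (rule H1_with_deriv_limit[OF J(1) bJ E(1) H b p pt' z]; assumption)+
  then show "u \<in> H1 J" "H1_tendsto J (\<lambda>n. zero_ext (L n) (f n)) u" by (auto simp: H1_def)
  let ?h = "\<lambda>n s. zero_ext (L n) (f n) s powr (3/2)"
  let ?h' = "\<lambda>n s. 3/2 * (zero_ext (L n) (f n) s powr (1/2) * zero_ext' (L n) (f' n) s)"
  let ?v' = "\<lambda>s. 3/2 * (F s powr (1/2) * w s)"
  have H: "H1_with_deriv J (?h n) (?h' n)" for n
    by (rule warping.H1_zero_ext_powr[OF W J(1) J' D B])
  have b: "\<bar>?h n s\<bar> \<le> 2 * B powr (3/2)" "\<bar>?h' n s\<bar> \<le> 2 * B powr (3/2)" if "s \<in> J" for n s
    using warping.zero_ext_powr_bounds[OF W bds[OF that] B(2)] by auto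
  have p: "(\<lambda>n. ?h n s) \<longlonglongrightarrow> v s" if "s \<in> J" for s
  proof -
    have "F s \<noteq> 0" "v s = F s powr (3/2)" using pos[of s] v[of s] that J(2) by auto
    then show ?thesis using tendsto_powr[OF pt[OF that] tendsto_const] by simp
  qed
  have p': "(\<lambda>n. ?h' n s) \<longlonglongrightarrow> ?v' s" if s: "s \<in> J - E" for s
  proof -
    have "F s \<noteq> 0" using pos[of s] s J(2) by auto
    then show ?thesis using s by (intro tendsto_intros pt pt') auto
  qed
  have z: "?v' s = 0" if "s \<in> E" for s using that by (simp add: w_def)
  have "H1_with_deriv J v ?v'" "H1_tendsto J ?h v"
    by (rule H1_with_deriv_limit[OF J(1) bJ E(1) H b p p' z]; assumption)+
  then show "v \<in> H1 J" "H1_tendsto J ?h v" by (auto simp: H1_def)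
qed

text \<open>Otherwise some \<open>f n\<close> is smaller at \<open>t\<close> than at \<open>x\<close> and \<open>y\<close>, and it has an interior minimum between them.
The sphere of latitude there is minimal, and its area is too small.\<close>

lemma limit_pos_between:
  fixes F :: "real \<Rightarrow> real"
  assumes R: "\<And>n. rot_sym Q P (L n) (f n) (f' n) (f'' n) (g n)"
    and W: "\<And>n. warping (L n) (f n) (f' n) (f'' n)"
    and A: "0 < A" and MinA: "\<And>n. ennreal A \<le> MinA (g n)"
    and lim: "uniform_limit {0..D} (\<lambda>n. zero_ext (L n) (f n)) F sequentially"
    and x: "0 \<le> x" "x < t" "0 < F x" and y: "t < y" "y \<le> D" "0 < F y"
  shows "0 < F t"
proof (rule ccontr)
  assume Ft: "\<not> 0 < F t"
  define K where "K = 6 * measure lborel slice_dom"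
  have K: "0 \<le> K" by (simp add: K_def)
  \<comment> \<open>Half the values at \<open>x\<close> and \<open>y\<close> makes room for the minimum; the root makes the area less than \<open>A\<close>.\<close>
  define e where "e = min (min (F x / 2) (F y / 2)) (sqrt (A / (K + 1)))"
  have e: "0 < e" "2 * e \<le> F x" "2 * e \<le> F y" using x(3) y(3) A K by (auto simp: e_def)
  have "e\<^sup>2 \<le> (sqrt (A / (K + 1)))\<^sup>2" using e(1) by (intro power_mono) (auto simp: e_def)
  then have "e\<^sup>2 \<le> A / (K + 1)" using A K by simp
  then have "(K + 1) * e\<^sup>2 \<le> A" using K by (simp add: field_simps)
  moreover have "(K + 1) * e\<^sup>2 = K * e\<^sup>2 + e\<^sup>2" by (simp add: distrib_right)
  ultimately have Ke: "K * e\<^sup>2 < A" using zero_less_power[OF e(1), of 2] by linarith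
  have "\<forall>\<^sub>F n in sequentially. \<forall>s\<in>{0..D}. dist (zero_ext (L n) (f n) s) (F s) < e"
    using e(1) by (intro uniform_limitD[OF lim])
  then obtain n where n: "\<And>s. s \<in> {0..D} \<Longrightarrow> dist (zero_ext (L n) (f n) s) (F s) < e"
    using eventually_happens'[OF sequentially_bot] by blast
  interpret W: warping "L n" "f n" "f' n" "f'' n" by (rule W)
  let ?F = "zero_ext (L n) (f n)"
  have Fx: "e < ?F x" and Fy: "e < ?F y" and Ft: "?F t < e"
    using n[of x] n[of y] n[of t] x y e Ft unfolding dist_real_def abs_less_iff by auto
  have "continuous_on {x..y} ?F"
    by (rule continuous_on_subset[OF W.continuous_zero_ext[of y]]) (use x in auto)
  then obtain s where s: "s \<in> {x..y}" "\<And>r. r \<in> {x..y} \<Longrightarrow> ?F s \<le> ?F r"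
    using continuous_attains_inf[of "{x..y}" ?F] x y by auto
  have "?F s < e" using s(2)[of t] x y Ft by auto
  then have "s \<noteq> x" "s \<noteq> y" using Fx Fy by auto
  then have s': "x < s" "s < y" using s(1) by auto
  have "y < L n" using Fy e(1) W.zero_ext_pos_iff[of y] by simp
  then have sL: "0 < s" "s < L n" using s' x by auto
  have fe: "?F r = f n r" if "r \<in> {x..y}" for r
    using that x \<open>y < L n\<close> by (simp add: zero_ext_def)
  have "f' n s = 0"
  proof (rule DERIV_local_min)
    show "(f n has_real_derivative f' n s) (at s)" using sL by (intro W.deriv) simp
    show "0 < min (s - x) (y - s)" using s' by simp
    show "\<forall>r. \<bar>s - r\<bar> < min (s - x) (y - s) \<longrightarrow> f n s \<le> f n r"
    proof (intro allI impI)
      fix r assume "\<bar>s - r\<bar> < min (s - x) (y - s)"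
      then have "r \<in> {x..y}" by auto
      then show "f n s \<le> f n r" using s(2)[of r] fe[of r] fe[of s] s(1) by simp
    qed
  qed
  then have "MinA (g n) \<le> ennreal (K * (f n s)\<^sup>2)"
    unfolding K_def by (rule rot_sym.MinA_le[OF R sL])
  then have "ennreal A \<le> ennreal (K * (f n s)\<^sup>2)" using MinA[of n] by (rule order.trans[rotated])
  then have "A \<le> K * (f n s)\<^sup>2" using K by (simp add: ennreal_le_iff)
  moreover have "(f n s)\<^sup>2 \<le> e\<^sup>2"
    using \<open>?F s < e\<close> fe[OF s(1)] W.zero_ext_nonneg[of s] by (intro power_mono) auto
  then have "K * (f n s)\<^sup>2 \<le> K * e\<^sup>2" using K by (rule mult_left_mono)
  ultimately show False using Ke by linarith
qed

lemma frame_id: "frame (\<lambda>v. v) (\<lambda>v. v)"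
  by unfold_locales (auto simp: orthogonal_transformation_def linear_iff)

theorem theorem4p8:
  fixes D A :: real
    and L :: "nat \<Rightarrow> real"
    and f :: "nat \<Rightarrow> real \<Rightarrow> real"
    and g :: "nat \<Rightarrow> metric"
    and \<sigma> :: "nat \<Rightarrow> nat"
    and f_lim :: "real \<Rightarrow> real"
  assumes "D > 0" and "A > 0"
    and "\<And>j. L j > 0"
    and "\<And>j. smooth_on {0..L j} (f j)"
    and "\<And>j. f j 0 = 0" and "\<And>j. f j (L j) = 0"
    and "\<And>j s. s \<in> {0<..<L j} \<Longrightarrow> f j s > 0"
    and "\<And>j. (f j has_real_derivative 1) (at 0 within {0..L j})"
    and "\<And>j. (f j has_real_derivative -1) (at (L j) within {0..L j})"
    and "\<And>j. rot_sym_metric (L j) (f j) (g j)"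
    and "\<And>j. Diam (g j) \<le> ennreal D"
    and "\<And>j. nonneg_scalar_curvature (g j)"
    and "\<And>j. MinA (g j) \<ge> ennreal A"
    and "strict_mono \<sigma>"
    and "uniform_limit {0..D} (\<lambda>j. zero_ext (L (\<sigma> j)) (f (\<sigma> j))) f_lim sequentially"
  defines "I \<equiv> {a_inf D f_lim <..< b_inf D f_lim}"
  shows "\<exists>\<rho> h_lim. strict_mono \<rho> \<and>
           h_lim \<in> H1 I \<and>
           (\<forall>s\<in>I. 0 \<le> h_lim s) \<and>
           H1_loc_tendsto I (\<lambda>j s. zero_ext (L (\<sigma> (\<rho> j))) (f (\<sigma> (\<rho> j))) s powr (3/2)) h_lim \<and>
           (\<forall>s\<in>I. h_lim s powr (2/3) = f_lim s) \<and>
           (\<lambda>s. h_lim s powr (2/3)) \<in> H1 I \<and>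
           (\<exists>\<tau>. strict_mono \<tau> \<and>
              H1_loc_tendsto I (\<lambda>j. zero_ext (L (\<sigma> (\<rho> (\<tau> j)))) (f (\<sigma> (\<rho> (\<tau> j)))))
                (\<lambda>s. h_lim s powr (2/3)))"
proof -
  have "\<exists>p. rot_sym (\<lambda>v. v) (\<lambda>v. v) (L j) (f j) (fst p) (snd p) (g j) \<and> warping (L j) (f j) (fst p) (snd p)" for j
  proof -
    obtain f' f'' where c: "continuous_on {0..L j} (f j)" "continuous_on {0..L j} f'"
      and e: "f' 0 = 1" "f' (L j) = -1"
      and d: "\<And>s. s \<in> {0<..<L j} \<Longrightarrow> (f j has_real_derivative f' s) (at s)"
        "\<And>s. s \<in> {0<..<L j} \<Longrightarrow> (f' has_real_derivative f'' s) (at s)"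
      using smooth_warping_derivatives[OF assms(4)[of j] assms(3) assms(8,9)] by blast
    have R: "rot_sym (\<lambda>v. v) (\<lambda>v. v) (L j) (f j) f' f'' (g j)"
      using assms(3,7,10) d by (intro rot_sym.intro rot_sym_axioms.intro frame_id) auto
    have "warping (L j) (f j) f' f''"
    proof
      show "2 * f j s * f'' s \<le> 1 - (f' s)\<^sup>2" if "s \<in> {0<..<L j}" for s
        using that by (intro rot_sym.scalar_curvature_ineq[OF R assms(12)]) auto
    qed (use assms(3,5,6,7) c e d in auto)
    with R show ?thesis by (intro exI[of _ "(f', f'')"]) simp
  qed
  then obtain p where p: "\<And>j. rot_sym (\<lambda>v. v) (\<lambda>v. v) (L j) (f j) (fst (p j)) (snd (p j)) (g j)"
    "\<And>j. warping (L j) (f j) (fst (p j)) (snd (p j))"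
    by metis
  define f' f'' where "f' j = fst (p (\<sigma> j))" and "f'' j = snd (p (\<sigma> j))" for j
  have R: "rot_sym (\<lambda>v. v) (\<lambda>v. v) (L (\<sigma> j)) (f (\<sigma> j)) (f' j) (f'' j) (g (\<sigma> j))"
    and W: "warping (L (\<sigma> j)) (f (\<sigma> j)) (f' j) (f'' j)" for j
    using p by (simp_all add: f'_def f''_def)
  note lim = assms(15)
  have LD: "L j \<le> D" for j
    using order.trans[OF Diam_ge[OF assms(10,3)] assms(11)] \<open>D > 0\<close> by (simp add: ennreal_le_iff)
  have pt: "(\<lambda>j. zero_ext (L (\<sigma> j)) (f (\<sigma> j)) s) \<longlonglongrightarrow> f_lim s" if "s \<in> {0..D}" for s
    by (rule tendsto_uniform_limitI[OF lim that])
  have nonneg: "0 \<le> f_lim s" if "s \<in> {0..D}" for s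
    by (rule LIMSEQ_le_const[OF pt[OF that]]) (use warping.zero_ext_nonneg[OF W] in blast)
  have "zero_ext (L (\<sigma> j)) (f (\<sigma> j)) 0 = 0" "zero_ext (L (\<sigma> j)) (f (\<sigma> j)) D = 0" for j
    using assms(5,6) LD[of "\<sigma> j"] by (auto simp: zero_ext_def)
  then have ends: "f_lim 0 = 0" "f_lim D = 0"
    using pt[of 0] pt[of D] \<open>D > 0\<close> by (simp_all add: LIMSEQ_const_iff)
  define a b where "a = a_inf D f_lim" and "b = b_inf D f_lim"
  have bdd: "bdd_above {s \<in> {0..D}. \<forall>t\<in>{0..s}. f_lim t = 0}" "bdd_below {s \<in> {0..D}. \<forall>t\<in>{s..D}. f_lim t = 0}"
    by (auto intro: bdd_aboveI[of _ D] bdd_belowI[of _ 0])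
  have a0: "0 \<le> a" unfolding a_def a_inf_def
    by (intro cSup_upper bdd) (use \<open>D > 0\<close> ends in auto)
  have bD: "b \<le> D" unfolding b_def b_inf_def
    by (intro cInf_lower bdd) (use \<open>D > 0\<close> ends in auto)
  have I: "I = {a<..<b}" by (simp add: I_def a_def b_def)
  have I0: "{a<..<b} \<subseteq> {0<..<D}" using a0 bD by auto
  \<comment> \<open>By the choice of \<open>a\<close> and \<open>b\<close> the limit is positive somewhere on each side of \<open>t\<close>, or at \<open>t\<close> itself.\<close>
  have pos: "0 < f_lim t" if t: "t \<in> {a<..<b}" for t
  proof -
    have tD: "t \<in> {0..D}" using t I0 by auto
    have "\<exists>x\<in>{0..t}. f_lim x \<noteq> 0"
    proof (rule ccontr)
      assume "\<not> (\<exists>x\<in>{0..t}. f_lim x \<noteq> 0)"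
      then have "t \<le> a" unfolding a_def a_inf_def
        by (intro cSup_upper bdd) (use tD in auto)
      then show False using t by simp
    qed
    then obtain x where x: "x \<in> {0..t}" "f_lim x \<noteq> 0" by blast
    have "\<exists>y\<in>{t..D}. f_lim y \<noteq> 0"
    proof (rule ccontr)
      assume "\<not> (\<exists>y\<in>{t..D}. f_lim y \<noteq> 0)"
      then have "b \<le> t" unfolding b_def b_inf_def
        by (intro cInf_lower bdd) (use tD in auto)
      then show False using t by simp
    qed
    then obtain y where y: "y \<in> {t..D}" "f_lim y \<noteq> 0" by blast
    have xy: "0 < f_lim x" "0 < f_lim y"
      using nonneg[of x] nonneg[of y] x y tD by auto
    show ?thesis
    proof (cases "x = t \<or> y = t")
      case True
      then show ?thesis using xy by auto
    next
      case False
      then show ?thesis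
        using x y xy by (intro limit_pos_between[OF R W assms(2,13) lim, of x t y]) auto
    qed
  qed
  define h where "h s = f_lim s powr (3/2)" for s
  have h: "h s powr (2/3) = f_lim s" if "s \<in> {a<..<b}" for s
    using pos[OF that] by (simp add: h_def powr_powr)
  have H: "(\<lambda>s. h s powr (2/3)) \<in> H1 J"
    "H1_tendsto J (\<lambda>j. zero_ext (L (\<sigma> j)) (f (\<sigma> j))) (\<lambda>s. h s powr (2/3))"
    "h \<in> H1 J" "H1_tendsto J (\<lambda>j s. zero_ext (L (\<sigma> j)) (f (\<sigma> j)) s powr (3/2)) h"
    if "open J" "J \<subseteq> I" for J
    using warping_H1_limits[OF W less_imp_le[OF \<open>D > 0\<close>] lim I0 pos that(1) that(2)[unfolded I] h h_def] by auto
  have loc: "H1_loc_tendsto I (\<lambda>j s. zero_ext (L (\<sigma> j)) (f (\<sigma> j)) s powr (3/2)) h"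
    "H1_loc_tendsto I (\<lambda>j. zero_ext (L (\<sigma> j)) (f (\<sigma> j))) (\<lambda>s. h s powr (2/3))"
    unfolding H1_loc_tendsto_def using H(2,4) closure_subset by (meson order.trans)+
  have "open I" "I \<subseteq> I" by (simp_all add: I)
  note HI = H(1,3)[OF this]
  \<comment> \<open>The whole sequence converges, so both subsequences are the identity.\<close>
  have id: "strict_mono (\<lambda>n::nat. n)" by (rule strict_monoI)
  show ?thesis
  proof (intro exI conjI)
    show "strict_mono (\<lambda>n::nat. n)" "strict_mono (\<lambda>n::nat. n)" by (rule id)+
    show "\<forall>s\<in>I. 0 \<le> h s" by (simp add: h_def)
    show "\<forall>s\<in>I. h s powr (2/3) = f_lim s" using h I by blast
  qed (rule HI loc)+
qed

end
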